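(* Let $m,n \geq 2$ be integers and let $\alpha$ be a nonzero real number. (i) Suppose $\alpha > 0$. If $\alpha \in \mathbb{N} \cup [n-2,\infty)$, then $(H_{st}^\alpha)_{s,t=1}^n \in \mathbb{P}_{mn}(\mathbb{C})$ for all $(H_{st})_{s,t=1}^n \in \mathbb{P}_{mn}(\mathbb{C})$ such that every block $H_{st}$ lies in $\mathbb{P}_m(\mathbb{C})$ and the blocks $H_{st}$ pairwise commute. (ii) Suppose $\alpha > 0$. If $\alpha \notin \mathbb{N} \cup [n-2,\infty)$, then there exist matrices $H_{st} \in \mathbb{P}_m(\mathbb{C})$, $1 \leq s,t \leq n$, such that $(H_{st})_{s,t=1}^n \in \mathbb{P}_{mn}(\mathbb{C})$ and the blocks $H_{st}$ pairwise commute, but $(H_{st}^\alpha)_{s,t=1}^n$ is not positive semidefinite. (iii) If $\alpha < 0$, there exist real symmetric positive definite $m \times m$ matrices $H_{st}$, $s,t = 1,\dots,n$, such that $(H_{st})_{s,t=1}^n \in \mathbb{P}_{mn}(\mathbb{R})$, but $(H_{st}^\alpha)_{s,t=1}^n$ is not positive semidefinite.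
   Context: $\mathbb{N} = \{1,2,3,\dots\}$. For $S \subset \mathbb{C}$, $\mathbb{P}_N(S)$ denotes the set of $N \times N$ Hermitian positive semidefinite matrices with entries in $S$. For a Hermitian positive semidefinite matrix $B$ and real $\alpha$, the power $B^\alpha$ is defined through the spectral decomposition of $B$, i.e. by applying $x \mapsto x^\alpha$ to the eigenvalues, with the convention $0^\alpha := 0$. *)

theory Defs
  imports Complex_Main "Jordan_Normal_Form.Schur_Decomposition"
begin

definition hermitian :: "complex mat \<Rightarrow> bool" where
  "hermitian A \<longleftrightarrow> mat_adjoint A = A"

text \<open>With the order on the complex numbers, \<open>0 \<le> z\<close> says that \<open>z\<close> is real and nonnegative;
  \<open>(A *\<^sub>v x) \<bullet>c x\<close> is the quadratic form \<open>x\<^sup>* A x\<close>.\<close>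

definition psd :: "complex mat \<Rightarrow> bool" where
  "psd A \<longleftrightarrow> hermitian A \<and> (\<forall>x \<in> carrier_vec (dim_row A). 0 \<le> (A *\<^sub>v x) \<bullet>c x)"

definition pos_def :: "complex mat \<Rightarrow> bool" where
  "pos_def A \<longleftrightarrow> hermitian A \<and>
    (\<forall>x \<in> carrier_vec (dim_row A). x \<noteq> 0\<^sub>v (dim_row A) \<longrightarrow> 0 < (A *\<^sub>v x) \<bullet>c x)"

definition psd_mats :: "nat \<Rightarrow> complex set \<Rightarrow> complex mat set" where
  "psd_mats N S = {A \<in> carrier_mat N N. psd A \<and> elements_mat A \<subseteq> S}"

definition real_sym_pos_def :: "nat \<Rightarrow> complex mat \<Rightarrow> bool" where
  "real_sym_pos_def N A \<longleftrightarrow>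
    A \<in> carrier_mat N N \<and> elements_mat A \<subseteq> \<real> \<and> A\<^sup>T = A \<and> pos_def A"

definition unitary :: "complex mat \<Rightarrow> bool" where
  "unitary U \<longleftrightarrow> square_mat U \<and> mat_adjoint U * U = 1\<^sub>m (dim_row U)"

definition spectral_form :: "nat \<Rightarrow> complex mat \<Rightarrow> (nat \<Rightarrow> real) \<Rightarrow> complex mat" where
  "spectral_form N U d = U * mat_diag N (\<lambda>i. complex_of_real (d i)) * mat_adjoint U"

text \<open>The definite description does not depend on the chosen decomposition, see
  \<open>mat_power_spectral_form\<close> below.  For psd \<open>B\<close> all \<open>d i\<close> are nonnegative, and
  \<open>0 powr \<alpha> = 0\<close> for every \<open>\<alpha>\<close>.\<close>

definition mat_power :: "complex mat \<Rightarrow> real \<Rightarrow> complex mat" where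
  "mat_power B \<alpha> = (THE C. \<exists>U d. U \<in> carrier_mat (dim_row B) (dim_row B) \<and> unitary U \<and>
     B = spectral_form (dim_row B) U d \<and>
     C = spectral_form (dim_row B) U (\<lambda>i. d i powr \<alpha>))"

text \<open>The \<open>mn \<times> mn\<close> matrix whose \<open>(s,t)\<close> block, for \<open>s, t < n\<close>, is the \<open>m \<times> m\<close> matrix \<open>H s t\<close>.\<close>

definition block_mat :: "nat \<Rightarrow> nat \<Rightarrow> (nat \<Rightarrow> nat \<Rightarrow> complex mat) \<Rightarrow> complex mat" where
  "block_mat m n H =
     mat (m * n) (m * n) (\<lambda>(i, j). H (i div m) (j div m) $$ (i mod m, j mod m))"

definition blocks_commute :: "nat \<Rightarrow> (nat \<Rightarrow> nat \<Rightarrow> complex mat) \<Rightarrow> bool" where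
  "blocks_commute n H \<longleftrightarrow>
     (\<forall>s<n. \<forall>t<n. \<forall>p<n. \<forall>q<n. H s t * H p q = H p q * H s t)"

lemma mat_adjoint_carrier:
  assumes "A \<in> carrier_mat N N"
  shows "mat_adjoint A \<in> carrier_mat N N"
  using assms by (intro carrier_matI) (simp_all add: mat_adjoint_def)

lemma spectral_form_unique:
  fixes f :: "real \<Rightarrow> real"
  assumes U: "U \<in> carrier_mat N N" "unitary U" and V: "V \<in> carrier_mat N N" "unitary V"
    and eq: "spectral_form N U d = spectral_form N V e"
  shows "spectral_form N U (\<lambda>i. f (d i)) = spectral_form N V (\<lambda>i. f (e i))"
proof -
  define D where "D g = mat_diag N (\<lambda>i. complex_of_real (g i))" for g
  define U' V' where "U' = mat_adjoint U" and "V' = mat_adjoint V"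
  have c: "U \<in> carrier_mat N N" "V \<in> carrier_mat N N" "U' \<in> carrier_mat N N"
    "V' \<in> carrier_mat N N" "\<And>g. D g \<in> carrier_mat N N"
    using U V mat_adjoint_carrier by (auto simp: U'_def V'_def D_def)
  have u: "U' * U = 1\<^sub>m N" "V' * V = 1\<^sub>m N"
    using U V by (auto simp: unitary_def U'_def V'_def)
  have u': "U * U' = 1\<^sub>m N" "V * V' = 1\<^sub>m N"
    using mat_mult_left_right_inverse[OF c(3,1) u(1)] mat_mult_left_right_inverse[OF c(4,2) u(2)] .
  define W where "W = V' * U"
  have W: "W \<in> carrier_mat N N" using c by (auto simp: W_def)
  note ac = assoc_mult_mat[of _ N N _ N _ N] mult_carrier_mat[of _ N N _ N]
  have cancel: "U' * (U * X) = X" "V' * (V * X) = X" "U * (U' * X) = X" "V * (V' * X) = X"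
    if "X \<in> carrier_mat N N" for X
    using that c u u'
    by (simp_all add: assoc_mult_mat[of _ N N _ N _ N, symmetric] del: assoc_mult_mat)
  have sf: "spectral_form N U g = U * (D g * U')" "spectral_form N V g = V * (D g * V')" for g
    using c unfolding spectral_form_def D_def[symmetric] U'_def[symmetric] V'_def[symmetric]
    by (simp_all add: ac)
  have E: "U * (D d * U') = V * (D e * V')"
    using eq sf by simp
  have "W * D d = V' * (U * (D d * (U' * U)))"
    unfolding W_def u using c by (simp add: ac right_mult_one_mat[of _ N N])
  also have "\<dots> = V' * ((U * (D d * U')) * U)" using c by (simp add: ac)
  also have "\<dots> = V' * ((V * (D e * V')) * U)" by (simp only: E)
  also have "\<dots> = D e * W"
    unfolding W_def using c by (simp add: ac cancel)
  finally have WD: "W * D d = D e * W" .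
  have R: "(W * D g) $$ (i,j) = W $$ (i,j) * complex_of_real (g j)"
    "(D g * W) $$ (i,j) = complex_of_real (g i) * W $$ (i,j)" if "i < N" "j < N" for i j g
    using that W by (simp_all add: D_def mat_diag_mult_left[of _ N N] mat_diag_mult_right[of _ N N])
  have dimD: "dim_row (D g) = N" "dim_col (D g) = N" for g
    by (simp_all add: D_def mat_diag_def)
  have WF: "W * D (\<lambda>i. f (d i)) = D (\<lambda>i. f (e i)) * W"
  proof (rule eq_matI)
    fix i j assume "i < dim_row (D (\<lambda>i. f (e i)) * W)" "j < dim_col (D (\<lambda>i. f (e i)) * W)"
    then have ij: "i < N" "j < N" using W dimD by auto
    have "W $$ (i,j) * complex_of_real (d j) = complex_of_real (e i) * W $$ (i,j)"
      by (simp only: R[OF ij, symmetric] WD)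
    then have "W $$ (i,j) = 0 \<or> d j = e i" by auto
    then show "(W * D (\<lambda>i. f (d i))) $$ (i,j) = (D (\<lambda>i. f (e i)) * W) $$ (i,j)"
      using R[OF ij] by auto
  qed (use W dimD in auto)
  have "U * (D (\<lambda>i. f (d i)) * U') = V * ((W * D (\<lambda>i. f (d i))) * U')"
    using c by (simp add: W_def ac cancel)
  also have "\<dots> = V * ((D (\<lambda>i. f (e i)) * W) * U')" by (simp only: WF)
  also have "\<dots> = V * (D (\<lambda>i. f (e i)) * V')" using c by (simp add: W_def ac u' right_mult_one_mat[of _ N N])
  finally show ?thesis by (simp add: sf)
qed

lemma mat_power_spectral_form:
  assumes "U \<in> carrier_mat N N" "unitary U"
  shows "mat_power (spectral_form N U d) \<alpha> = spectral_form N U (\<lambda>i. d i powr \<alpha>)"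
proof -
  have dim: "dim_row (spectral_form N U d) = N"
    using assms by (simp add: spectral_form_def)
  show ?thesis
    unfolding mat_power_def dim
  proof (rule the_equality)
    show "\<exists>V e. V \<in> carrier_mat N N \<and> unitary V \<and> spectral_form N U d = spectral_form N V e \<and>
      spectral_form N U (\<lambda>i. d i powr \<alpha>) = spectral_form N V (\<lambda>i. e i powr \<alpha>)"
    proof (rule exI, rule exI, intro conjI)
      show "U \<in> carrier_mat N N" "unitary U" by (fact assms)+
    qed (rule refl)+
  next
    fix C
    assume "\<exists>V e. V \<in> carrier_mat N N \<and> unitary V \<and> spectral_form N U d = spectral_form N V e \<and>
      C = spectral_form N V (\<lambda>i. e i powr \<alpha>)"
    then obtain V e where V: "V \<in> carrier_mat N N" "unitary V"
      and eq: "spectral_form N U d = spectral_form N V e"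
      and C: "C = spectral_form N V (\<lambda>i. e i powr \<alpha>)" by (elim exE conjE)
    have "spectral_form N U (\<lambda>i. d i powr \<alpha>) = spectral_form N V (\<lambda>i. e i powr \<alpha>)"
      by (rule spectral_form_unique[OF assms V eq])
    then show "C = spectral_form N U (\<lambda>i. d i powr \<alpha>)"
      by (simp only: C)
  qed
qed

end

theory Submission
  imports "HOL-Analysis.Generalised_Binomial_Theorem" Defs
begin

unbundle no vec_syntax and no inner_syntax

text \<open>Finitely many pairwise commuting hermitian matrices have a common orthonormal basis of
  eigenvectors (\<open>commuting_hermitian_simultaneous_diagonalization\<close>).  In such a basis the block matrix
  becomes a direct sum of \<open>m\<close> real symmetric matrices of size \<open>n\<close>, the \<open>k\<close>-th of which collects the
  \<open>k\<close>-th eigenvalues \<open>d s t k\<close> of the blocks, and taking powers of the blocks means taking powers of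
  these entries (\<open>psd_block_spectral_iff\<close>).  The theorem thus reduces to the question which entrywise
  powers preserve positive semidefiniteness of matrices with nonnegative entries; conversely, a
  counterexample to the entrywise question gives one for blocks that are multiples of the identity.

  For natural exponents the entrywise question is answered by the Schur product theorem, and for real
  exponents \<open>\<alpha> \<ge> n - 2\<close> by the theorem of FitzGerald and Horn (\<open>real_psd_powr\<close>), by induction on \<open>n\<close>:
  deform the matrix to a rank one matrix with the same last row and column.  The derivative of the
  power along the way is a Schur product that lives in size \<open>n - 1\<close> and involves the exponent
  \<open>\<alpha> - 1\<close>, so the induction hypothesis makes it positive semidefinite.

  For other positive exponents the matrices \<open>1 + \<epsilon> s t\<close> are counterexamples
  (\<open>ex_powr_quad_form_negative\<close>): the binomial series of \<open>(1 + \<epsilon> s t) powr \<alpha>\<close> has a negative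
  coefficient of index less than \<open>n\<close>, and a vector orthogonal to all lower powers of \<open>s\<close> detects it as
  \<open>\<epsilon>\<close> tends to zero.  For negative exponents the matrix with 2 on and 1 off the diagonal is one.\<close>

section \<open>Real positive semidefinite matrices\<close>

text \<open>Real matrices are functions of two indices, of which only those below \<open>n\<close> matter.  The same
  function then stands for all its leading principal submatrices, which is what inductions on the
  size need.\<close>

definition quad_form :: "nat \<Rightarrow> (nat \<Rightarrow> nat \<Rightarrow> real) \<Rightarrow> (nat \<Rightarrow> real) \<Rightarrow> real" where
  "quad_form n A v = (\<Sum>i<n. \<Sum>j<n. v i * v j * A i j)"

definition real_psd :: "nat \<Rightarrow> (nat \<Rightarrow> nat \<Rightarrow> real) \<Rightarrow> bool" where
  "real_psd n A \<longleftrightarrow> (\<forall>i<n. \<forall>j<n. A i j = A j i) \<and> (\<forall>v. 0 \<le> quad_form n A v)"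

lemma real_psdI:
  assumes "\<And>i j. i < n \<Longrightarrow> j < n \<Longrightarrow> A i j = A j i" "\<And>v. 0 \<le> quad_form n A v"
  shows "real_psd n A"
  using assms unfolding real_psd_def by blast

lemma real_psd_sym: "real_psd n A \<Longrightarrow> i < n \<Longrightarrow> j < n \<Longrightarrow> A i j = A j i"
  unfolding real_psd_def by blast

lemma real_psd_nonneg: "real_psd n A \<Longrightarrow> 0 \<le> quad_form n A v"
  unfolding real_psd_def by blast

lemma quad_form_cong:
  assumes "\<And>i j. i < n \<Longrightarrow> j < n \<Longrightarrow> A i j = B i j"
  shows "quad_form n A = quad_form n B"
  unfolding quad_form_def using assms by (intro ext sum.cong) auto

lemma real_psd_cong:
  assumes "\<And>i j. i < n \<Longrightarrow> j < n \<Longrightarrow> A i j = B i j"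
  shows "real_psd n A \<longleftrightarrow> real_psd n B"
  unfolding real_psd_def using quad_form_cong[OF assms, of n "\<lambda>i j. i" "\<lambda>i j. j"] assms
  by (auto simp: assms)

lemma quad_form_extend:
  assumes "k \<le> n"
  shows "quad_form n A (\<lambda>i. if i < k then v i else 0) = quad_form k A v"
proof -
  let ?v = "\<lambda>i. if i < k then v i else 0"
  have "quad_form n A ?v = (\<Sum>i<k. \<Sum>j<n. ?v i * ?v j * A i j)"
    unfolding quad_form_def using assms by (intro sum.mono_neutral_right) auto
  also have "\<dots> = (\<Sum>i<k. \<Sum>j<k. ?v i * ?v j * A i j)"
    using assms by (intro sum.cong[OF refl] sum.mono_neutral_right) auto
  finally show ?thesis by (simp add: quad_form_def)
qed

lemma real_psd_mono:
  assumes "real_psd n A" "k \<le> n"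
  shows "real_psd k A"
proof (rule real_psdI)
  show "0 \<le> quad_form k A v" for v
    using real_psd_nonneg[OF assms(1)] quad_form_extend[OF assms(2), of A v] by metis
qed (use real_psd_sym[OF assms(1)] assms(2) in auto)

lemma quad_form_rank_one: "quad_form n (\<lambda>i j. z i * z j) v = (\<Sum>i<n. v i * z i)\<^sup>2"
  unfolding quad_form_def power2_eq_square sum_product
  by (intro sum.cong refl) (simp add: algebra_simps)

lemma quad_form_add: "quad_form n (\<lambda>i j. A i j + B i j) v = quad_form n A v + quad_form n B v"
  unfolding quad_form_def by (simp add: algebra_simps sum.distrib)

lemma quad_form_cmult: "quad_form n (\<lambda>i j. c * A i j) v = c * quad_form n A v"
  unfolding quad_form_def by (simp add: sum_distrib_left mult_ac)

lemma real_psd_rank_one: "real_psd n (\<lambda>i j. z i * z j)"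
  by (rule real_psdI) (simp_all add: quad_form_rank_one)

lemma real_psd_add:
  assumes "real_psd n A" "real_psd n B" shows "real_psd n (\<lambda>i j. A i j + B i j)"
  by (rule real_psdI)
    (simp_all add: quad_form_add real_psd_nonneg[OF assms(1)] real_psd_nonneg[OF assms(2)]
      real_psd_sym[OF assms(1)] real_psd_sym[OF assms(2)])

lemma real_psd_cmult:
  assumes "real_psd n A" "0 \<le> c" shows "real_psd n (\<lambda>i j. c * A i j)"
  by (rule real_psdI)
    (simp_all add: quad_form_cmult real_psd_nonneg[OF assms(1)] assms(2)
      real_psd_sym[OF assms(1)])

text \<open>The form as a quadratic polynomial in the last coordinate.\<close>

lemma quad_form_Suc:
  assumes "\<And>i. i < n \<Longrightarrow> A n i = A i n"
  shows "quad_form (Suc n) A v =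
    quad_form n A v + 2 * v n * (\<Sum>i<n. v i * A i n) + (v n)\<^sup>2 * A n n"
proof -
  have "(\<Sum>j<n. v n * v j * A n j) = v n * (\<Sum>i<n. v i * A i n)"
    using assms by (simp add: sum_distrib_left mult_ac)
  moreover have "(\<Sum>i<n. v i * v n * A i n) = v n * (\<Sum>i<n. v i * A i n)"
    by (simp add: sum_distrib_left mult_ac)
  ultimately show ?thesis
    by (simp add: quad_form_def sum.distrib power2_eq_square)
qed

lemma real_psd_diag: 
  assumes "real_psd n A" "i < n" shows "0 \<le> A i i"
proof -
  have row: "(\<Sum>l<n. (if l = i then 1 else 0) * A k l) = A k i" for k
  proof -
    have "(\<Sum>l<n. (if l = i then 1 else 0) * A k l) = (\<Sum>l<n. if l = i then A k l else 0)"
      by (intro sum.cong) auto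
    then show ?thesis using assms(2) by simp
  qed
  have "quad_form n A (\<lambda>k. if k = i then 1 else 0) =
      (\<Sum>k<n. if k = i then (\<Sum>l<n. if l = i then A k l else 0) else 0)"
    unfolding quad_form_def using assms(2) by (intro sum.cong refl) (simp add: sum.delta row)
  also have "\<dots> = A i i"
    using assms by simp
  finally show ?thesis
    using real_psd_nonneg[OF assms(1)] by metis
qed

text \<open>Subtracting the rank one matrix that agrees with \<open>A\<close> in the last row and column leaves a positive
  semidefinite matrix: its value at \<open>v\<close> is the minimum of the form of \<open>A\<close> over the last coordinate,
  the others being those of \<open>v\<close>.  If \<open>A n n = 0\<close>, the last column of \<open>A\<close> vanishes, and so does \<open>z\<close>
  because division by zero yields zero.\<close>

lemma schur_complement:
  assumes A: "real_psd (Suc n) A"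
    and z_def: "\<And>i. z i = A i n / sqrt (A n n)"
  shows "\<And>i. i < Suc n \<Longrightarrow> A i n = z i * z n"
    and "real_psd n (\<lambda>i j. A i j - z i * z j)"
proof -
  have sym: "A i j = A j i" if "i < Suc n" "j < Suc n" for i j
    using real_psd_sym[OF A that] .
  have ann: "A n n \<ge> 0" by (rule real_psd_diag[OF A]) simp
  have expand: "quad_form n A v + 2 * t * (\<Sum>i<n. v i * A i n) + t\<^sup>2 * A n n \<ge> 0" for v t
  proof -
    have "quad_form n A (v(n := t)) = quad_form n A v"
      unfolding quad_form_def by (intro sum.cong) auto
    moreover have "(\<Sum>i<n. (v(n := t)) i * A i n) = (\<Sum>i<n. v i * A i n)"
      by (intro sum.cong) auto
    ultimately show ?thesis
      using real_psd_nonneg[OF A, of "v(n := t)"] quad_form_Suc[of n A "v(n:=t)"] sym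
      by simp
  qed
  have zero: "A i n = 0" if i: "i < n" and 0: "A n n = 0" for i
  proof (rule ccontr)
    assume ne: "A i n \<noteq> 0"
    define v where "v = (\<lambda>k. if k = i then 1 else 0::real)"
    have v: "(\<Sum>k<n. v k * A k n) = A i n"
    proof -
      have "(\<Sum>k<n. v k * A k n) = (\<Sum>k<n. if k = i then A k n else 0)"
        by (intro sum.cong) (auto simp: v_def)
      then show ?thesis using i by simp
    qed
    (* the form is affine in the last coordinate, so this value makes it negative *)
    have "quad_form n A v + 2 * (- (quad_form n A v + 1) / (2 * A i n)) * A i n \<ge> 0"
      using expand[of v "- (quad_form n A v + 1) / (2 * A i n)"] v 0 by simp
    then show False using ne by (simp add: field_simps)
  qed
  show col: "A i n = z i * z n" if "i < Suc n" for i
  proof (cases "A n n = 0")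
    case True
    then show ?thesis using that zero[of i] by (cases "i = n") (auto simp: z_def)
  next
    case False
    then show ?thesis using ann by (simp add: z_def)
  qed
  show "real_psd n (\<lambda>i j. A i j - z i * z j)"
  proof (rule real_psdI)
    fix v
    have eq: "quad_form n (\<lambda>i j. A i j - z i * z j) v = quad_form n A v - (\<Sum>i<n. v i * z i)\<^sup>2"
      using quad_form_add[of n A "\<lambda>i j. (-1) * (z i * z j)" v]
        quad_form_cmult[of n "-1" "\<lambda>i j. z i * z j" v] quad_form_rank_one[of n z v] by simp
    have zs: "(\<Sum>i<n. v i * z i) = (\<Sum>i<n. v i * A i n) / sqrt (A n n)"
      by (simp add: z_def sum_divide_distrib)
    show "0 \<le> quad_form n (\<lambda>i j. A i j - z i * z j) v"
    proof (cases "A n n = 0")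
      case True
      then show ?thesis using eq zs expand[of v 0] by simp
    next
      case False
      define S where "S = (\<Sum>i<n. v i * A i n)"
      (* completing the square in the last coordinate *)
      have "quad_form n A v + 2 * (- S / A n n) * S + (- S / A n n)\<^sup>2 * A n n \<ge> 0"
        using expand[of v "- S / A n n"] unfolding S_def .
      moreover have "2 * (- S / A n n) * S + (- S / A n n)\<^sup>2 * A n n = - (S / sqrt (A n n))\<^sup>2"
        using False ann by (simp add: power2_eq_square field_simps)
      ultimately show ?thesis unfolding eq zs S_def by linarith
    qed
  qed (use sym in \<open>simp add: mult.commute\<close>)
qed

text \<open>Splitting off Schur complements one index at a time writes \<open>A\<close> as a sum of rank one matrices.\<close>

lemma real_psd_gram:
  assumes "real_psd n A"
  shows "\<exists>Z. \<forall>i<n. \<forall>j<n. A i j = (\<Sum>k<n. Z k i * Z k j)"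
  using assms
proof (induction n arbitrary: A)
  case (Suc n)
  define z where "z i = A i n / sqrt (A n n)" for i
  note z = schur_complement[OF Suc.prems z_def]
  obtain Z where Z: "\<And>i j. i < n \<Longrightarrow> j < n \<Longrightarrow> A i j - z i * z j = (\<Sum>k<n. Z k i * Z k j)"
    using Suc.IH[OF z(2)] by blast
  define Y where "Y k i = (if k = n then z i else if i = n then 0 else Z k i)" for k i
  have "A i j = (\<Sum>k<Suc n. Y k i * Y k j)" if ij: "i < Suc n" "j < Suc n" for i j
  proof -
    have "(\<Sum>k<n. Y k i * Y k j) = (if i = n \<or> j = n then 0 else \<Sum>k<n. Z k i * Z k j)"
      by (auto simp: Y_def)
    moreover have "A i j = z i * z j" if "i = n \<or> j = n"
      using that z(1) ij real_psd_sym[OF Suc.prems ij] by (auto simp: mult.commute)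
    ultimately show ?thesis
      using Z[of i j] ij by (auto simp: Y_def less_Suc_eq algebra_simps)
  qed
  then show ?case by blast
qed simp

text \<open>The Schur product theorem: in the Gram decomposition of \<open>A\<close>, each rank one summand multiplies
  \<open>B\<close> entrywise into a matrix congruent to \<open>B\<close> by a diagonal matrix.\<close>

lemma real_psd_schur_product:
  assumes A: "real_psd n A" and B: "real_psd n B"
  shows "real_psd n (\<lambda>i j. A i j * B i j)"
proof (rule real_psdI)
  fix v
  obtain Z where Z: "\<And>i j. i < n \<Longrightarrow> j < n \<Longrightarrow> A i j = (\<Sum>k<n. Z k i * Z k j)"
    using real_psd_gram[OF A] by blast
  have "quad_form n (\<lambda>i j. A i j * B i j) v
      = (\<Sum>i<n. \<Sum>j<n. \<Sum>k<n. (v i * Z k i) * (v j * Z k j) * B i j)"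
    unfolding quad_form_def
    by (intro sum.cong refl) (simp add: Z sum_distrib_left sum_distrib_right algebra_simps)
  also have "\<dots> = (\<Sum>i<n. \<Sum>k<n. \<Sum>j<n. (v i * Z k i) * (v j * Z k j) * B i j)"
    by (rule sum.cong[OF refl sum.swap])
  also have "\<dots> = (\<Sum>k<n. quad_form n B (\<lambda>i. v i * Z k i))"
    unfolding quad_form_def by (rule sum.swap)
  also have "\<dots> \<ge> 0"
    by (intro sum_nonneg real_psd_nonneg[OF B])
  finally show "0 \<le> quad_form n (\<lambda>i j. A i j * B i j) v" .
qed (use real_psd_sym[OF A] real_psd_sym[OF B] in simp)

section \<open>Entrywise powers preserving positivity\<close>

lemma real_psd_power:
  assumes "real_psd n A" "k \<ge> 1"
  shows "real_psd n (\<lambda>i j. A i j ^ k)"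
  using assms(2)
proof (induction k rule: nat_induct_at_least)
  case base
  then show ?case using assms by simp
next
  case (Suc k)
  then show ?case using real_psd_schur_product[OF assms(1)] by simp
qed

lemma real_psd_powr_nat:
  assumes "real_psd n A" "\<And>i j. i < n \<Longrightarrow> j < n \<Longrightarrow> 0 \<le> A i j" "k \<ge> 1"
  shows "real_psd n (\<lambda>i j. A i j powr real k)"
  using real_psd_power[OF assms(1,3)] assms(2,3)
  by (subst real_psd_cong[of n _ "\<lambda>i j. A i j ^ k"]) (auto simp: powr_realpow')

text \<open>Powers of a rank one matrix have rank one.  Apart from the rank one matrix of the Schur complement,
  there is only the excess at the corner \<open>A 0 0\<close>, which stays nonnegative because
  \<open>x \<mapsto> x powr \<alpha>\<close> is increasing.\<close>

lemma real_psd_2_powr: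
  assumes A: "real_psd 2 A" and nn: "\<And>i j. i < 2 \<Longrightarrow> j < 2 \<Longrightarrow> 0 \<le> A i j"
    and \<alpha>: "\<alpha> > 0"
  shows "real_psd 2 (\<lambda>i j. A i j powr \<alpha>)"
proof -
  define z where "z i = A i 1 / sqrt (A 1 1)" for i
  have A': "real_psd (Suc 1) A" using A by (simp add: numeral_2_eq_2)
  note z = schur_complement[OF A' z_def]
  have z1: "A 0 1 = z 0 * z 1" "A 1 0 = z 0 * z 1" "A 1 1 = z 1 * z 1"
    using z(1)[of 0] z(1)[of 1] real_psd_sym[OF A, of 0 1] by simp_all
  have znn: "z 0 \<ge> 0" "z 1 \<ge> 0" using nn by (auto simp: z_def)
  have "z 0 * z 0 \<le> A 0 0"
    using real_psd_diag[OF z(2), of 0] by simp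
  then have le: "(z 0 * z 0) powr \<alpha> \<le> A 0 0 powr \<alpha>"
    using \<alpha> znn by (intro powr_mono2) auto
  show ?thesis
  proof (rule real_psdI)
    fix v :: "nat \<Rightarrow> real"
    have "quad_form 2 (\<lambda>i j. A i j powr \<alpha>) v
       = v 0 * v 0 * (A 0 0 powr \<alpha> - (z 0 * z 0) powr \<alpha>)
         + (v 0 * z 0 powr \<alpha> + v 1 * z 1 powr \<alpha>)\<^sup>2"
      using znn z1
      by (simp add: quad_form_def numeral_2_eq_2 powr_mult power2_eq_square algebra_simps)
    then show "0 \<le> quad_form 2 (\<lambda>i j. A i j powr \<alpha>) v"
      using le by simp
  qed (use real_psd_sym[OF A] in simp)
qed

text \<open>The theorem of FitzGerald and Horn.  Join the rank one matrix \<open>z z\<^sup>T\<close> of the Schur complement to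
  \<open>A\<close> by the segment \<open>L \<theta> = z z\<^sup>T + \<theta> D\<close>, where \<open>D = A - z z\<^sup>T\<close>.  The derivative of the entrywise
  power of \<open>L \<theta>\<close> is \<open>\<alpha>\<close> times the Schur product of \<open>D\<close> with the entrywise power of \<open>L \<theta>\<close> to the
  exponent \<open>\<alpha> - 1\<close>.  As \<open>D\<close> vanishes in the last row and column, only the leading principal
  submatrix of size one less enters, for which the exponent \<open>\<alpha> - 1\<close> is large enough by induction.
  Hence the form of the power increases from \<open>\<theta> = 0\<close>, where it is a square, to \<open>\<theta> = 1\<close>.\<close>

lemma real_psd_powr:
  assumes "n \<ge> 2" "real_psd n A" "\<And>i j. i < n \<Longrightarrow> j < n \<Longrightarrow> 0 \<le> A i j"
    and "\<alpha> > 0" "\<alpha> \<ge> real n - 2"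
  shows "real_psd n (\<lambda>i j. A i j powr \<alpha>)"
  using assms
proof (induction n arbitrary: A \<alpha> rule: nat_induct_at_least)
  case base
  then show ?case by (intro real_psd_2_powr) auto
next
  case (Suc n A \<alpha>)
  note A = Suc.prems(1) and nn = Suc.prems(2)
  define z where "z i = A i n / sqrt (A n n)" for i
  note z = schur_complement[OF A z_def]
  have znn: "z i \<ge> 0" if "i < Suc n" for i using nn that by (auto simp: z_def)
  have \<alpha>: "\<alpha> \<ge> 1" using Suc by simp
  show ?case
  proof (cases "\<alpha> = 1")
    case True
    then show ?thesis using A nn by (subst real_psd_cong[of _ _ A]) auto
  next
    case False
    define D where "D i j = A i j - z i * z j" for i j
    define L where "L \<theta> i j = z i * z j + \<theta> * D i j" for \<theta> i j
    have D0: "D i n = 0" "D n i = 0" if "i < Suc n" for i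
      using z(1)[OF that] real_psd_sym[OF A that, of n] by (auto simp: D_def mult.commute)
    have Lnn: "0 \<le> L \<theta> i j" if "0 \<le> \<theta>" "\<theta> \<le> 1" "i < Suc n" "j < Suc n" for \<theta> i j
    proof -
      have "L \<theta> i j = (1 - \<theta>) * (z i * z j) + \<theta> * A i j"
        by (simp add: L_def D_def algebra_simps)
      then show ?thesis using nn znn that by simp
    qed
    have Lpsd: "real_psd n (L \<theta>)" if "0 \<le> \<theta>" "\<theta> \<le> 1" for \<theta>
      unfolding L_def using that
      by (intro real_psd_add real_psd_rank_one real_psd_cmult) (auto simp: D_def z(2))
    have dpsd: "real_psd n (\<lambda>i j. D i j * L \<theta> i j powr (\<alpha> - 1))" if "0 \<le> \<theta>" "\<theta> \<le> 1" for \<theta>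
      using z(2) \<alpha> False Suc.prems Lnn that unfolding D_def[symmetric]
      by (intro real_psd_schur_product Suc.IH Lpsd) auto
    show ?thesis
    proof (rule real_psdI)
      fix v :: "nat \<Rightarrow> real"
      define g where "g \<theta> = quad_form (Suc n) (\<lambda>i j. L \<theta> i j powr \<alpha>) v" for \<theta>
      (* an entry L \<theta> i j with \<theta> strictly inside the interval is positive unless it is constantly
         zero, so the chain rule applies although the power need not be differentiable at zero *)
      have deriv: "((\<lambda>\<theta>. L \<theta> i j powr \<alpha>) has_real_derivative \<alpha> * (D i j * L \<theta> i j powr (\<alpha> - 1))) (at \<theta>)"
        if \<theta>: "0 < \<theta>" "\<theta> < 1" and ij: "i < Suc n" "j < Suc n" for \<theta> i j
      proof (cases "D i j = 0")
        case True
        then show ?thesis by (simp add: L_def)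
      next
        case False
        have "L \<theta> i j = (1 - \<theta>) * (z i * z j) + \<theta> * A i j"
          by (simp add: L_def D_def algebra_simps)
        moreover have "z i * z j > 0 \<or> A i j > 0" "z i * z j \<ge> 0" "A i j \<ge> 0"
          using False nn[OF ij] znn[OF ij(1)] znn[OF ij(2)]
          by (auto simp: D_def less_le)
        ultimately have "L \<theta> i j > 0"
          using \<theta> by (auto intro: add_pos_nonneg add_nonneg_pos)
        then show ?thesis unfolding L_def
          by (auto intro!: derivative_eq_intros)
      qed
      have "g 0 \<le> g 1"
      proof (rule DERIV_nonneg_imp_increasing_open[of 0 1 g])
        fix \<theta> :: real assume \<theta>: "0 < \<theta>" "\<theta> < 1"
        let ?M = "\<lambda>i j. D i j * L \<theta> i j powr (\<alpha> - 1)"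
        have "(g has_real_derivative quad_form (Suc n) (\<lambda>i j. \<alpha> * ?M i j) v) (at \<theta>)"
          unfolding g_def quad_form_def using deriv[OF \<theta>]
          by (intro DERIV_sum DERIV_cmult) auto
        moreover have "quad_form (Suc n) (\<lambda>i j. \<alpha> * ?M i j) v = \<alpha> * quad_form n ?M v"
          unfolding quad_form_cmult using D0 by (subst quad_form_Suc) auto
        ultimately show "\<exists>y. (g has_real_derivative y) (at \<theta>) \<and> 0 \<le> y"
          using real_psd_nonneg[OF dpsd[of \<theta>], of v] \<theta> \<alpha> by auto
      next
        show "continuous_on {0..1} g"
          unfolding g_def quad_form_def using Lnn \<alpha>
          by (intro continuous_intros continuous_on_powr') (auto simp: L_def intro!: continuous_intros)
      qed simp
      moreover have "g 1 = quad_form (Suc n) (\<lambda>i j. A i j powr \<alpha>) v"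
        by (simp add: g_def L_def D_def)
      moreover have "g 0 = quad_form (Suc n) (\<lambda>i j. z i powr \<alpha> * z j powr \<alpha>) v"
      proof -
        have "quad_form (Suc n) (\<lambda>i j. L 0 i j powr \<alpha>)
            = quad_form (Suc n) (\<lambda>i j. z i powr \<alpha> * z j powr \<alpha>)"
          using znn by (intro quad_form_cong) (simp add: L_def powr_mult)
        then show ?thesis by (simp add: g_def)
      qed
      ultimately show "0 \<le> quad_form (Suc n) (\<lambda>i j. A i j powr \<alpha>) v"
        unfolding quad_form_rank_one by (metis zero_le_power2 order_trans)
    qed (use real_psd_sym[OF A] in simp)
  qed
qed

section \<open>Entrywise powers destroying positivity\<close>

text \<open>The coefficients of an iterated forward difference: on polynomials of degree at most \<open>J\<close> it sees
  the leading coefficient only.  Each step of the induction composes with one more difference, which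
  lowers the degree by one.\<close>

lemma ex_moment_annihilator:
  "\<exists>v::nat \<Rightarrow> real. (\<forall>j<J. (\<Sum>s<Suc J. v s * real s ^ j) = 0) \<and> (\<Sum>s<Suc J. v s * real s ^ J) \<noteq> 0"
proof (induction J)
  case 0
  show ?case by (rule exI[of _ "\<lambda>_. 1"]) simp
next
  case (Suc J)
  then obtain v :: "nat \<Rightarrow> real" where v: "\<And>j. j < J \<Longrightarrow> (\<Sum>s<Suc J. v s * real s ^ j) = 0"
    and vJ: "(\<Sum>s<Suc J. v s * real s ^ J) \<noteq> 0" by blast
  define w where "w s = (if s = 0 then 0 else v (s - 1)) - (if s = Suc J then 0 else v s)" for s
  have "(\<Sum>s<Suc (Suc J). w s * real s ^ j) = (\<Sum>i<j. real (j choose i) * (\<Sum>s<Suc J. v s * real s ^ i))" for j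
  proof -
    have "(\<Sum>s<Suc (Suc J). w s * real s ^ j)
       = (\<Sum>s<Suc (Suc J). (if s = 0 then 0 else v (s - 1)) * real s ^ j)
         - (\<Sum>s<Suc (Suc J). (if s = Suc J then 0 else v s) * real s ^ j)"
      by (simp only: w_def left_diff_distrib sum_subtractf)
    also have "(\<Sum>s<Suc (Suc J). (if s = 0 then 0 else v (s - 1)) * real s ^ j)
        = (\<Sum>s<Suc J. v s * (real s + 1) ^ j)"
      by (subst sum.lessThan_Suc_shift) (simp add: add.commute)
    also have "(\<Sum>s<Suc (Suc J). (if s = Suc J then 0 else v s) * real s ^ j)
        = (\<Sum>s<Suc J. v s * real s ^ j)"
      by (subst sum.lessThan_Suc) (simp add: less_Suc_eq)
    also have "(\<Sum>s<Suc J. v s * (real s + 1) ^ j) - (\<Sum>s<Suc J. v s * real s ^ j)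
        = (\<Sum>s<Suc J. v s * (\<Sum>i<j. real (j choose i) * real s ^ i))"
    proof -
      have "(real s + 1) ^ j - real s ^ j = (\<Sum>i<j. real (j choose i) * real s ^ i)" for s
        using binomial_ring[of "real s" 1 j] by (simp add: lessThan_Suc_atMost[symmetric])
      then show ?thesis
        by (simp only: sum_subtractf[symmetric] right_diff_distrib[symmetric])
    qed
    also have "\<dots> = (\<Sum>s<Suc J. \<Sum>i<j. real (j choose i) * (v s * real s ^ i))"
      by (simp add: sum_distrib_left mult_ac del: sum.lessThan_Suc)
    also have "\<dots> = (\<Sum>i<j. \<Sum>s<Suc J. real (j choose i) * (v s * real s ^ i))"
      by (rule sum.swap)
    finally show ?thesis by (simp only: sum_distrib_left)
  qed
  note w = this
  show ?case
  proof (intro exI[of _ w] conjI allI impI)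
    fix j assume "j < Suc J"
    then show "(\<Sum>s<Suc (Suc J). w s * real s ^ j) = 0"
      unfolding w by (intro sum.neutral) (auto simp del: sum.lessThan_Suc simp: v)
  next
    have "(\<Sum>s<Suc (Suc J). w s * real s ^ Suc J) = real (Suc J) * (\<Sum>s<Suc J. v s * real s ^ J)"
      unfolding w by (subst sum.lessThan_Suc) (simp del: sum.lessThan_Suc add: v)
    then show "(\<Sum>s<Suc (Suc J). w s * real s ^ Suc J) \<noteq> 0"
      using vJ by simp
  qed
qed

text \<open>In \<open>\<alpha> (\<alpha> - 1) \<cdots> (\<alpha> - f - 1)\<close> the last factor is the only negative one.\<close>

lemma gbinomial_first_negative:
  fixes \<alpha> :: real
  assumes "real f < \<alpha>" "\<alpha> < real (Suc f)"
  shows "\<alpha> gchoose (f + 2) < 0"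
proof -
  have "(\<Prod>i<Suc f. \<alpha> - real i) > 0"
    using assms by (intro prod_pos) auto
  then have "(\<Prod>i<Suc (Suc f). \<alpha> - real i) < 0"
    using assms by (subst prod.lessThan_Suc) (simp add: mult_pos_neg del: prod.lessThan_Suc)
  then show ?thesis
    by (simp add: gbinomial_prod_rev atLeast0LessThan divide_neg_pos del: prod.lessThan_Suc)
qed

text \<open>By the binomial series the form of the matrix \<open>(1 + \<epsilon> s t) powr \<alpha>\<close> at \<open>v\<close> is a power series in
  \<open>\<epsilon>\<close> whose \<open>j\<close>-th coefficient is \<open>\<alpha> gchoose j\<close> times the squared \<open>j\<close>-th moment of \<open>v\<close>.  Choosing
  \<open>v\<close> to annihilate all moments below \<open>f + 2\<close> makes the first negative binomial coefficient the
  leading one, and it decides the sign for small \<open>\<epsilon>\<close>.\<close>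

lemma ex_powr_quad_form_negative:
  fixes \<alpha> :: real
  assumes f: "real f < \<alpha>" "\<alpha> < real (Suc f)"
  shows "\<exists>\<epsilon>>0. \<exists>v. quad_form (f + 3) (\<lambda>s t. (1 + \<epsilon> * real s * real t) powr \<alpha>) v < 0"
proof -
  define J where "J = f + 2"
  obtain v :: "nat \<Rightarrow> real" where v: "\<And>j. j < J \<Longrightarrow> (\<Sum>s<Suc J. v s * real s ^ j) = 0"
    and vJ: "(\<Sum>s<Suc J. v s * real s ^ J) \<noteq> 0"
    using ex_moment_annihilator[of J] by blast
  define c where "c j = (\<alpha> gchoose j) * (\<Sum>s<Suc J. v s * real s ^ j)\<^sup>2" for j
  define q where "q \<epsilon> = quad_form (Suc J) (\<lambda>s t. (1 + \<epsilon> * real s * real t) powr \<alpha>) v" for \<epsilon>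
  (* all the binomial series in play converge at this radius *)
  define K :: real where "K = 1 / (real J * real J + 1)"
  have K: "K > 0" "K * real s * real t < 1" if "s < Suc J" "t < Suc J" for s t
  proof -
    show "K > 0" by (simp add: K_def add_nonneg_pos)
    have "real s * real t \<le> real J * real J" using that by (intro mult_mono) auto
    then have "real s * real t < real J * real J + 1" by linarith
    moreover have "0 < real J * real J + 1" by (simp add: add_nonneg_pos)
    ultimately show "K * real s * real t < 1" by (simp add: K_def)
  qed
  have K0: "K > 0" by (rule K[of 0 0]) simp_all
  have sums: "(\<lambda>j. c j * \<epsilon> ^ j) sums q \<epsilon>" if \<epsilon>: "0 < \<epsilon>" "\<epsilon> \<le> K" for \<epsilon>
  proof -
    have "(\<lambda>j. \<Sum>s<Suc J. \<Sum>t<Suc J. v s * v t * ((\<alpha> gchoose j) * (\<epsilon> * real s * real t) ^ j)) sums q \<epsilon>"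
      unfolding q_def quad_form_def
    proof (intro sums_sum sums_mult gen_binomial_real)
      fix s t assume st: "s \<in> {..<Suc J}" "t \<in> {..<Suc J}"
      have "\<epsilon> * (real s * real t) \<le> K * (real s * real t)"
        using \<epsilon> by (intro mult_right_mono) auto
      then show "\<bar>\<epsilon> * real s * real t\<bar> < 1"
        using K(2)[of s t] st \<epsilon> by (auto simp: abs_mult mult.assoc)
    qed
    moreover have "(\<Sum>s<Suc J. \<Sum>t<Suc J. v s * v t * ((\<alpha> gchoose j) * (\<epsilon> * real s * real t) ^ j)) = c j * \<epsilon> ^ j" for j
      unfolding c_def power2_eq_square sum_product sum_distrib_left sum_distrib_right
      by (intro sum.cong refl) (simp add: power_mult_distrib mult_ac)
    ultimately show ?thesis by simp
  qed
  have c0: "c j = 0" if "j < J" for j using v[OF that] by (simp add: c_def del: sum.lessThan_Suc)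
  have cJ: "c J < 0"
    using gbinomial_first_negative[OF f, folded J_def] vJ
    by (simp add: c_def mult_neg_pos del: sum.lessThan_Suc)
  define g where "g \<epsilon> = (\<Sum>j. c (j + J) * \<epsilon> ^ j)" for \<epsilon>
  have tail: "(\<lambda>j. c (j + J) * \<epsilon> ^ j) sums (q \<epsilon> / \<epsilon> ^ J)" if \<epsilon>: "0 < \<epsilon>" "\<epsilon> \<le> K" for \<epsilon>
  proof -
    have "(\<lambda>j. c (j + J) * \<epsilon> ^ (j + J)) sums (q \<epsilon> - (\<Sum>j<J. c j * \<epsilon> ^ j))"
      using sums_split_initial_segment[OF sums[OF \<epsilon>], of J] .
    moreover have "(\<Sum>j<J. c j * \<epsilon> ^ j) = 0" using c0 by (intro sum.neutral) auto
    ultimately have "(\<lambda>j. c (j + J) * \<epsilon> ^ (j + J) / \<epsilon> ^ J) sums (q \<epsilon> / \<epsilon> ^ J)"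
      by (intro sums_divide) simp
    then show ?thesis using \<epsilon> by (simp add: power_add)
  qed
  have "isCont g 0"
    unfolding g_def using tail[of K] K0
    by (intro isCont_powser[where K = K]) (auto simp: sums_iff)
  moreover have "g 0 = c J"
    unfolding g_def using powser_zero[of "\<lambda>j. c (j + J)"] by simp
  ultimately have "(g \<longlongrightarrow> c J) (at_right 0)"
    unfolding isCont_def by (auto intro: tendsto_within_subset)
  then have "\<forall>\<^sub>F \<epsilon> in at_right 0. g \<epsilon> < 0"
    using cJ by (rule order_tendstoD)
  moreover have "\<forall>\<^sub>F \<epsilon> in at_right 0. \<epsilon> \<in> {0<..<K}"
    using K0 by (rule eventually_at_right_real)
  ultimately have "\<forall>\<^sub>F \<epsilon> in at_right (0::real). g \<epsilon> < 0 \<and> \<epsilon> \<in> {0<..<K}"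
    by (rule eventually_conj)
  then obtain \<epsilon> where \<epsilon>: "g \<epsilon> < 0" "0 < \<epsilon>" "\<epsilon> < K"
    using eventually_happens'[OF trivial_limit_at_right_real] by fastforce
  then have "q \<epsilon> / \<epsilon> ^ J < 0"
    using tail[of \<epsilon>] by (simp add: g_def sums_iff)
  then have "q \<epsilon> < 0" using \<epsilon> by (simp add: divide_less_0_iff)
  moreover have "Suc J = f + 3" by (simp add: J_def)
  ultimately show ?thesis using \<epsilon> unfolding q_def by metis
qed

text \<open>With \<open>f\<close> the integer part of \<open>\<alpha>\<close>, the condition \<open>\<alpha> < n - 2\<close> says that the \<open>f + 3\<close> points used
  above fit into size \<open>n\<close>.\<close>

lemma ex_real_psd_not_powr:
  assumes \<alpha>: "\<alpha> > 0" "\<alpha> \<notin> real ` {1..} \<union> {real n - 2..}"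
  shows "\<exists>A. real_psd n A \<and> (\<forall>s t. A s t > 0) \<and> \<not> real_psd n (\<lambda>s t. A s t powr \<alpha>)"
proof -
  define f where "f = nat \<lfloor>\<alpha>\<rfloor>"
  have f: "real f = of_int \<lfloor>\<alpha>\<rfloor>" using \<alpha>(1) by (simp add: f_def)
  have "real f \<noteq> \<alpha>"
    using \<alpha> by (cases "f = 0") (auto simp: image_iff)
  then have f1: "real f < \<alpha>" "\<alpha> < real (Suc f)"
    using f floor_correct[of \<alpha>] by linarith+
  then have "f + 3 \<le> n" using \<alpha> by auto
  obtain \<epsilon> v where \<epsilon>: "\<epsilon> > 0"
    and neg: "quad_form (f + 3) (\<lambda>s t. (1 + \<epsilon> * real s * real t) powr \<alpha>) v < 0"
    using ex_powr_quad_form_negative[OF f1] by blast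
  show ?thesis
  proof (intro exI[of _ "\<lambda>s t. 1 + \<epsilon> * real s * real t"] conjI allI)
    show "real_psd n (\<lambda>s t. 1 + \<epsilon> * real s * real t)"
      using real_psd_add[OF real_psd_rank_one[of n "\<lambda>_. 1"]
          real_psd_cmult[OF real_psd_rank_one[of n real], of \<epsilon>]] \<epsilon>
      by (simp add: mult.assoc)
    show "0 < 1 + \<epsilon> * real s * real t" for s t
      using \<epsilon> by (simp add: add_pos_nonneg)
    show "\<not> real_psd n (\<lambda>s t. (1 + \<epsilon> * real s * real t) powr \<alpha>)"
      using neg real_psd_nonneg[OF real_psd_mono[OF _ \<open>f + 3 \<le> n\<close>]] by (meson not_le)
  qed
qed

text \<open>A negative power reverses the order between the diagonal entry 2 and the off-diagonal entry 1, so
  the leading minor of size two becomes negative.\<close>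

lemma ex_real_psd_not_powr_neg:
  assumes "\<alpha> < 0" "n \<ge> 2"
  shows "\<exists>A. real_psd n A \<and> (\<forall>s t. A s t > 0) \<and> \<not> real_psd n (\<lambda>s t. A s t powr \<alpha>)"
proof (intro exI[of _ "\<lambda>s t. if s = t then 2 else 1"] conjI allI)
  show "real_psd n (\<lambda>s t. if s = t then 2 else 1)"
  proof (rule real_psdI)
    fix v :: "nat \<Rightarrow> real"
    have "quad_form n (\<lambda>s t. if s = t then 1 else 0) v = (\<Sum>i<n. v i * v i)"
      unfolding quad_form_def by (intro sum.cong refl) (simp add: if_distrib cong: if_cong)
    moreover have "quad_form n (\<lambda>s t. if s = t then 2 else 1) v
      = quad_form n (\<lambda>s t. 1 * 1 + (if s = t then 1 else 0)) v"
      by (rule fun_cong[OF quad_form_cong]) auto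
    ultimately show "0 \<le> quad_form n (\<lambda>s t. if s = t then 2 else 1) v"
      using quad_form_rank_one[of n "\<lambda>_. 1" v]
      unfolding quad_form_add by (simp add: sum_nonneg)
  qed auto
next
  have "quad_form 2 (\<lambda>s t. (if s = t then 2 else 1) powr \<alpha>) (\<lambda>s. if s = 0 then 1 else -1)
      = 2 * (2 powr \<alpha> - 1)"
    by (simp add: quad_form_def numeral_2_eq_2)
  moreover have "2 powr \<alpha> < (1::real)" using powr_less_mono[of \<alpha> 0 2] assms by simp
  ultimately show "\<not> real_psd n (\<lambda>s t. (if s = t then 2 else 1) powr \<alpha>)"
    using real_psd_nonneg[OF real_psd_mono[OF _ assms(2)]] by (smt (verit))
qed auto

section \<open>Simultaneous diagonalization of commuting hermitian matrices\<close>

text \<open>Bring \<open>A\<close> to upper triangular form \<open>B\<close>.  If a vector has its last nonzero coordinate at position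
  \<open>k\<close>, in the triangularizing basis, then \<open>A - B $$ (k, k)\<close> either annihilates it, so that it is an
  eigenvector, or moves its last nonzero coordinate to a smaller position.  This produces an
  eigenvector by applying only maps \<open>A - c\<close>, so that it stays in \<open>V\<close>.\<close>

lemma eigenvector_in_invariant_set:
  fixes A :: "complex mat"
  assumes A: "A \<in> carrier_mat m m" and V: "V \<subseteq> carrier_vec m"
    and inv: "\<And>v c. v \<in> V \<Longrightarrow> A *\<^sub>v v - c \<cdot>\<^sub>v v \<in> V"
    and v: "v \<in> V" "v \<noteq> 0\<^sub>v m"
  shows "\<exists>w\<in>V. w \<noteq> 0\<^sub>v m \<and> (\<exists>\<mu>. A *\<^sub>v w = \<mu> \<cdot>\<^sub>v w)"
proof -
  obtain es where "char_poly A = (\<Prod>a\<leftarrow>es. [:- a, 1:])"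
    using char_poly_factorized[OF A] by blast
  then obtain B where B: "B \<in> carrier_mat m m" "upper_triangular B" and "similar_mat A B"
    using schur_decomposition_exists[OF A] by blast
  then obtain P Q where "similar_mat_wit A B P Q" unfolding similar_mat_def by blast
  note PQ = similar_mat_witD2[OF A this]
  have main: "\<exists>w\<in>V. w \<noteq> 0\<^sub>v m \<and> (\<exists>\<mu>. A *\<^sub>v w = \<mu> \<cdot>\<^sub>v w)"
    if "k \<le> m" "v \<in> V" "v \<noteq> 0\<^sub>v m" "\<And>i. k \<le> i \<Longrightarrow> i < m \<Longrightarrow> (Q *\<^sub>v v) $ i = 0" for k v
    using that
  proof (induction k arbitrary: v)
    case (0 v)
    have vc: "v \<in> carrier_vec m" using 0 V by blast
    have "Q *\<^sub>v v = 0\<^sub>v m" using 0 PQ by (intro eq_vecI) auto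
    then have "(P * Q) *\<^sub>v v = 0\<^sub>v m"
      using PQ vc by (subst assoc_mult_mat_vec[of _ m m _ m]) auto
    then show ?case using PQ(1) vc 0 by simp
  next
    case (Suc k v)
    have vc: "v \<in> carrier_vec m" using Suc V by blast
    define y where "y = Q *\<^sub>v v"
    have y: "y \<in> carrier_vec m" using PQ vc by (simp add: y_def)
    define c where "c = B $$ (k, k)"
    define w where "w = A *\<^sub>v v - c \<cdot>\<^sub>v v"
    show ?case
    proof (cases "w = 0\<^sub>v m")
      case True
      have "A *\<^sub>v v = c \<cdot>\<^sub>v v"
      proof (rule eq_vecI)
        fix i assume "i < dim_vec (c \<cdot>\<^sub>v v)"
        then have i: "i < m" using vc by simp
        then have "w $ i = 0" using True by simp
        then show "(A *\<^sub>v v) $ i = (c \<cdot>\<^sub>v v) $ i" using i vc A by (simp add: w_def)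
      qed (use A vc in auto)
      then show ?thesis using Suc by blast
    next
      case False
      have "Q *\<^sub>v w = Q *\<^sub>v (A *\<^sub>v v) - c \<cdot>\<^sub>v y"
        unfolding w_def y_def using PQ(7) vc A
        by (simp add: mult_minus_distrib_mat_vec[of _ m m] mult_mat_vec[of _ m m])
      also have "Q *\<^sub>v (A *\<^sub>v v) = (Q * A) *\<^sub>v v"
        using PQ(7) vc A by (simp add: assoc_mult_mat_vec[of _ m m _ m])
      also have "Q * A = (Q * P) * (B * Q)"
        unfolding PQ(3) using PQ(4-7) by (simp add: assoc_mult_mat[of _ m m _ m _ m])
      also have "\<dots> = B * Q" using PQ by simp
      also have "(B * Q) *\<^sub>v v = B *\<^sub>v y"
        unfolding y_def using PQ vc by (simp add: assoc_mult_mat_vec[of _ m m _ m])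
      finally have Qw: "Q *\<^sub>v w = B *\<^sub>v y - c \<cdot>\<^sub>v y" .
      have "(Q *\<^sub>v w) $ i = 0" if i: "k \<le> i" "i < m" for i
      proof -
        have y0: "y $ j = 0" if "Suc k \<le> j" "j < m" for j
          using Suc.prems(4) that by (simp add: y_def)
        have B0: "B $$ (i, j) = 0" if "j < i" for j
          using B i that unfolding upper_triangular_def by auto
        have "(B *\<^sub>v y) $ i = (\<Sum>j\<in>{0..<m}. B $$ (i, j) * y $ j)"
          using i B y by (simp add: scalar_prod_def)
        also have "\<dots> = (\<Sum>j\<in>{0..<m}. if j = i then c * y $ i else 0)"
        proof (intro sum.cong refl)
          fix j assume "j \<in> {0..<m}"
          then show "B $$ (i, j) * y $ j = (if j = i then c * y $ i else 0)"
            using B0[of j] y0[of j] i by (cases "j < i"; cases "i = k") (auto simp: c_def)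
        qed
        also have "\<dots> = c * y $ i" using i by simp
        finally show ?thesis using i y B by (simp add: Qw)
      qed
      then show ?thesis using Suc.prems False inv[of v c] by (intro Suc.IH[of w]) (auto simp: w_def)
    qed
  qed
  show ?thesis by (rule main[of m v]) (use v in auto)
qed

text \<open>An eigenspace of \<open>A\<close> is invariant under every matrix commuting with \<open>A\<close>, so \<open>V\<close> can be shrunk to
  eigenspaces of one matrix after the other.\<close>

lemma common_eigenvector:
  fixes F :: "complex mat set"
  assumes "finite F" "F \<subseteq> carrier_mat m m"
    and "\<And>A B. A \<in> F \<Longrightarrow> B \<in> F \<Longrightarrow> A * B = B * A"
    and "V \<subseteq> carrier_vec m" "\<And>A v c. A \<in> F \<Longrightarrow> v \<in> V \<Longrightarrow> A *\<^sub>v v - c \<cdot>\<^sub>v v \<in> V"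
    and "v \<in> V" "v \<noteq> 0\<^sub>v m"
  shows "\<exists>w\<in>V. w \<noteq> 0\<^sub>v m \<and> (\<forall>A\<in>F. \<exists>\<mu>. A *\<^sub>v w = \<mu> \<cdot>\<^sub>v w)"
  using assms
proof (induction F arbitrary: V v rule: finite_induct)
  case empty
  then show ?case by blast
next
  case (insert A F V v)
  have A: "A \<in> carrier_mat m m" and F: "F \<subseteq> carrier_mat m m" using insert.prems by auto
  note V = insert.prems(3)
  obtain w \<mu> where w: "w \<in> V" "w \<noteq> 0\<^sub>v m" "A *\<^sub>v w = \<mu> \<cdot>\<^sub>v w"
    using eigenvector_in_invariant_set[OF A V _ insert.prems(5,6)] insert.prems(4) by blast
  define E where "E = {x \<in> V. A *\<^sub>v x = \<mu> \<cdot>\<^sub>v x}"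
  have "B *\<^sub>v x - c \<cdot>\<^sub>v x \<in> E" if B: "B \<in> F" and x: "x \<in> E" for B x c
  proof -
    have Bc: "B \<in> carrier_mat m m" and xc: "x \<in> carrier_vec m" and Ax: "A *\<^sub>v x = \<mu> \<cdot>\<^sub>v x"
      using F B x V by (auto simp: E_def)
    have "A *\<^sub>v (B *\<^sub>v x) = (A * B) *\<^sub>v x"
      using A Bc xc by (simp add: assoc_mult_mat_vec[of _ m m _ m])
    also have "\<dots> = (B * A) *\<^sub>v x" using insert.prems(2)[of A B] B by simp
    also have "\<dots> = \<mu> \<cdot>\<^sub>v (B *\<^sub>v x)"
      using A Bc xc by (simp add: assoc_mult_mat_vec[of _ m m _ m] Ax mult_mat_vec[of _ m m])
    finally have "A *\<^sub>v (B *\<^sub>v x - c \<cdot>\<^sub>v x) = \<mu> \<cdot>\<^sub>v (B *\<^sub>v x) - c \<cdot>\<^sub>v (\<mu> \<cdot>\<^sub>v x)"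
      using A Bc xc
      by (simp add: mult_minus_distrib_mat_vec[of _ m m] mult_mat_vec[of _ m m] Ax)
    also have "\<dots> = \<mu> \<cdot>\<^sub>v (B *\<^sub>v x - c \<cdot>\<^sub>v x)"
      using Bc xc by (intro eq_vecI) (auto simp: algebra_simps)
    finally show ?thesis using insert.prems(4)[of B x c] B x by (auto simp: E_def)
  qed
  moreover have "E \<subseteq> carrier_vec m" "w \<in> E" using V w by (auto simp: E_def)
  ultimately have "\<exists>u\<in>E. u \<noteq> 0\<^sub>v m \<and> (\<forall>B\<in>F. \<exists>\<mu>. B *\<^sub>v u = \<mu> \<cdot>\<^sub>v u)"
    using insert.prems(2) w(2) by (intro insert.IH[OF F]) auto
  then obtain u where "u \<in> E" "u \<noteq> 0\<^sub>v m" "\<forall>B\<in>F. \<exists>\<mu>. B *\<^sub>v u = \<mu> \<cdot>\<^sub>v u"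
    by blast
  then show ?case by (auto simp: E_def)
qed

lemma mat_adjoint_index:
  assumes "A \<in> carrier_mat n m" "i < m" "j < n"
  shows "mat_adjoint A $$ (i, j) = cnj (A $$ (j, i))"
  using assms unfolding mat_adjoint_def by (simp add: mat_of_rows_index)

lemma mult_mat_vec_index:
  assumes "A \<in> carrier_mat n m" "x \<in> carrier_vec m" "i < n"
  shows "(A *\<^sub>v x) $ i = (\<Sum>j<m. A $$ (i, j) * x $ j)"
  using assms by (simp add: scalar_prod_def atLeast0LessThan)

lemma cscalar_prod_sum:
  assumes "x \<in> carrier_vec n" "y \<in> carrier_vec n"
  shows "x \<bullet>c y = (\<Sum>i<n. x $ i * cnj (y $ i))"
  using assms by (simp add: scalar_prod_def atLeast0LessThan)

lemma hermitian_index: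
  assumes "A \<in> carrier_mat m m" "hermitian A" "i < m" "j < m"
  shows "A $$ (i, j) = cnj (A $$ (j, i))"
  using mat_adjoint_index[of A m m i j] assms by (simp add: hermitian_def)

lemma hermitianI:
  assumes "A \<in> carrier_mat m m" "\<And>i j. i < m \<Longrightarrow> j < m \<Longrightarrow> A $$ (i, j) = cnj (A $$ (j, i))"
  shows "hermitian A"
  unfolding hermitian_def
proof (rule eq_matI)
  fix i j assume "i < dim_row A" "j < dim_col A"
  then have ij: "i < m" "j < m" using assms(1) by auto
  show "mat_adjoint A $$ (i, j) = A $$ (i, j)"
    unfolding assms(2)[OF ij] by (rule mat_adjoint_index[OF assms(1) ij])
qed (use assms(1) mat_adjoint_carrier[OF assms(1)] in auto)

lemma hermitian_self_adjoint:
  assumes A: "A \<in> carrier_mat m m" "hermitian A" and xy: "x \<in> carrier_vec m" "y \<in> carrier_vec m"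
  shows "(A *\<^sub>v x) \<bullet>c y = x \<bullet>c (A *\<^sub>v y)"
proof -
  have "(A *\<^sub>v x) \<bullet>c y = (\<Sum>i<m. \<Sum>j<m. A $$ (i, j) * x $ j * cnj (y $ i))"
    using A xy by (simp add: cscalar_prod_sum[of _ m] mult_mat_vec_index[of _ m m] sum_distrib_right
        del: index_mult_mat_vec)
  also have "\<dots> = (\<Sum>j<m. \<Sum>i<m. A $$ (i, j) * x $ j * cnj (y $ i))" by (rule sum.swap)
  also have "\<dots> = (\<Sum>j<m. \<Sum>i<m. x $ j * cnj (A $$ (j, i) * y $ i))"
  proof (intro sum.cong refl)
    fix i j assume "j \<in> {..<m}" "i \<in> {..<m}"
    then show "A $$ (i, j) * x $ j * cnj (y $ i) = x $ j * cnj (A $$ (j, i) * y $ i)"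
      using hermitian_index[OF A, of i j] by simp
  qed
  also have "\<dots> = x \<bullet>c (A *\<^sub>v y)"
    using A xy by (simp add: cscalar_prod_sum[of _ m] mult_mat_vec_index[of _ m m] sum_distrib_left
        del: index_mult_mat_vec)
  finally show ?thesis .
qed

text \<open>Fewer than \<open>m\<close> linear conditions, filled up with zero rows, form a singular square matrix.\<close>

lemma ex_orthogonal_vector:
  fixes u :: "nat \<Rightarrow> complex vec"
  assumes "k < m" "\<And>i. i < k \<Longrightarrow> u i \<in> carrier_vec m"
  shows "\<exists>v\<in>carrier_vec m. v \<noteq> 0\<^sub>v m \<and> (\<forall>i<k. v \<bullet>c u i = 0)"
proof -
  define M where "M = mat m m (\<lambda>(i, j). if i < k then cnj (u i $ j) else 0)"
  have M: "M \<in> carrier_mat m m" by (simp add: M_def)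
  have prod0: "(\<Prod>i = 0..<m. M $$ (i, p i)) = 0" if "p permutes {0..<m}" for p
  proof (rule prod_zero)
    have "p k < m" using that assms(1) permutes_in_image[OF that, of k] by simp
    then show "\<exists>i\<in>{0..<m}. M $$ (i, p i) = 0"
      using assms(1) by (intro bexI[of _ k]) (auto simp: M_def)
  qed simp
  have "det M = 0"
    unfolding det_def'[OF M] by (intro sum.neutral ballI) (simp add: prod0 del: prod_zero_iff)
  then obtain v where v: "v \<in> carrier_vec m" "v \<noteq> 0\<^sub>v m" and Mv: "M *\<^sub>v v = 0\<^sub>v m"
    using det_0_iff_vec_prod_zero[OF M] by blast
  have "v \<bullet>c u i = 0" if "i < k" for i
  proof -
    have i: "i < m" using that assms(1) by simp
    have "v \<bullet>c u i = (M *\<^sub>v v) $ i"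
      using that i v assms(2)[OF that] M
      by (simp add: cscalar_prod_sum[of _ m] mult_mat_vec_index[of _ m m] mult.commute M_def
          del: index_mult_mat_vec)
    then show ?thesis using i by (simp add: Mv)
  qed
  then show ?thesis using v by blast
qed

text \<open>The orthogonal complement of common eigenvectors is invariant under hermitian matrices, so a
  further common eigenvector can be found in it until the dimension is exhausted.\<close>

lemma commuting_hermitian_orthonormal_eigenvectors:
  assumes F: "finite F" "F \<subseteq> carrier_mat m m" "\<And>A. A \<in> F \<Longrightarrow> hermitian A"
    "\<And>A B. A \<in> F \<Longrightarrow> B \<in> F \<Longrightarrow> A * B = B * A"
    and "k \<le> m"
  shows "\<exists>u. (\<forall>i<k. u i \<in> carrier_vec m \<and> (\<forall>A\<in>F. \<exists>\<mu>. A *\<^sub>v u i = \<mu> \<cdot>\<^sub>v u i))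
    \<and> (\<forall>i<k. \<forall>j<k. u i \<bullet>c u j = (if i = j then 1 else 0))"
  using \<open>k \<le> m\<close>
proof (induction k)
  case (Suc k)
  then obtain u where u: "\<And>i. i < k \<Longrightarrow> u i \<in> carrier_vec m"
    and eig: "\<And>i A. i < k \<Longrightarrow> A \<in> F \<Longrightarrow> \<exists>\<mu>. A *\<^sub>v u i = \<mu> \<cdot>\<^sub>v u i"
    and orth: "\<And>i j. i < k \<Longrightarrow> j < k \<Longrightarrow> u i \<bullet>c u j = (if i = j then 1 else 0)"
    by (metis Suc_leD)
  define V where "V = {v \<in> carrier_vec m. \<forall>i<k. v \<bullet>c u i = 0}"
  have inv: "A *\<^sub>v v - c \<cdot>\<^sub>v v \<in> V" if A: "A \<in> F" and v: "v \<in> V" for A v c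
  proof -
    have Ac: "A \<in> carrier_mat m m" and vc: "v \<in> carrier_vec m"
      using A v F by (auto simp: V_def)
    have "(A *\<^sub>v v - c \<cdot>\<^sub>v v) \<bullet>c u i = 0" if i: "i < k" for i
    proof -
      obtain \<mu> where \<mu>: "A *\<^sub>v u i = \<mu> \<cdot>\<^sub>v u i" using eig[OF i A] by blast
      have "(A *\<^sub>v v) \<bullet>c u i = v \<bullet>c (\<mu> \<cdot>\<^sub>v u i)"
        using hermitian_self_adjoint[OF Ac F(3)[OF A] vc u[OF i]] \<mu> by simp
      also have "\<dots> = 0"
        using v i vc u[OF i] by (simp add: V_def conjugate_smult_vec)
      finally show ?thesis
        using v i vc u[OF i] Ac
        by (simp add: minus_scalar_prod_distrib[of _ m] V_def)
    qed
    then show ?thesis using Ac vc by (simp add: V_def)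
  qed
  obtain v where "v \<in> V" "v \<noteq> 0\<^sub>v m"
    using ex_orthogonal_vector[of k m u] u Suc.prems by (auto simp: V_def)
  then obtain w where w: "w \<in> V" "w \<noteq> 0\<^sub>v m" and weig: "\<And>A. A \<in> F \<Longrightarrow> \<exists>\<mu>. A *\<^sub>v w = \<mu> \<cdot>\<^sub>v w"
    using common_eigenvector[OF F(1,2,4) _ inv, of v] by (auto simp: V_def)
  have wc: "w \<in> carrier_vec m" using w by (simp add: V_def)
  define r where "r = sqrt (Re (w \<bullet>c w))"
  have pos: "0 < w \<bullet>c w" using w wc by simp
  then have r: "r > 0" "w \<bullet>c w = complex_of_real (r * r)"
    by (auto simp: r_def less_complex_def complex_eq_iff)
  define x where "x = complex_of_real (1 / r) \<cdot>\<^sub>v w"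
  have xc: "x \<in> carrier_vec m" using wc by (simp add: x_def)
  have xx: "x \<bullet>c x = 1"
    using wc r by (simp add: x_def conjugate_smult_vec divide_simps)
  have xu: "x \<bullet>c u i = 0" if "i < k" for i
    using w wc u[OF that] that by (simp add: x_def V_def)
  have ux: "u i \<bullet>c x = 0" if "i < k" for i
    using w wc u[OF that] that xu[OF that] xc
      conjugate_conjugate_sprod[OF u[OF that] xc]
      conjugate_vec_sprod_comm[OF xc u[OF that]]
    by (metis conjugate_zero)
  have xeig: "\<exists>\<mu>. A *\<^sub>v x = \<mu> \<cdot>\<^sub>v x" if A: "A \<in> F" for A
  proof -
    obtain \<mu> where "A *\<^sub>v w = \<mu> \<cdot>\<^sub>v w" using weig[OF A] by blast
    moreover have "A \<in> carrier_mat m m" using A F by blast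
    ultimately have "A *\<^sub>v x = \<mu> \<cdot>\<^sub>v x"
      using wc by (simp add: x_def mult_mat_vec[of _ m m] smult_smult_assoc mult.commute)
    then show ?thesis by blast
  qed
  show ?case
    by (rule exI[of _ "u(k := x)"])
      (auto simp: less_Suc_eq u eig orth xc xx xu ux xeig)
qed simp

lemma spectral_form_carrier:
  "U \<in> carrier_mat m m \<Longrightarrow> spectral_form m U d \<in> carrier_mat m m"
  unfolding spectral_form_def using mat_adjoint_carrier[of U m]
  by (intro mult_carrier_mat[of _ _ m]) auto

lemma spectral_form_index:
  assumes U: "U \<in> carrier_mat m m" and ij: "i < m" "j < m"
  shows "spectral_form m U d $$ (i, j) = (\<Sum>k<m. U $$ (i, k) * complex_of_real (d k) * cnj (U $$ (j, k)))"
  unfolding spectral_form_def mat_diag_mult_right[OF U]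
  using U ij mat_adjoint_carrier[OF U]
  by (simp add: scalar_prod_def mat_adjoint_index[OF U] atLeast0LessThan)

lemma unitary_columns:
  assumes U: "U \<in> carrier_mat m m" "unitary U" and kl: "k < m" "l < m"
  shows "(\<Sum>i<m. cnj (U $$ (i, k)) * U $$ (i, l)) = (if k = l then 1 else 0)"
proof -
  have "(mat_adjoint U * U) $$ (k, l) = (\<Sum>i<m. cnj (U $$ (i, k)) * U $$ (i, l))"
    using U(1) kl mat_adjoint_carrier[OF U(1)]
    by (simp add: scalar_prod_def mat_adjoint_index[OF U(1)] atLeast0LessThan)
  then show ?thesis using U kl by (simp add: unitary_def)
qed

lemma commuting_hermitian_simultaneous_diagonalization:
  assumes F: "finite F" "F \<subseteq> carrier_mat m m" "\<And>A. A \<in> F \<Longrightarrow> hermitian A"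
    "\<And>A B. A \<in> F \<Longrightarrow> B \<in> F \<Longrightarrow> A * B = B * A"
  shows "\<exists>U\<in>carrier_mat m m. unitary U \<and> (\<forall>A\<in>F. \<exists>d. A = spectral_form m U d)"
proof -
  obtain u where u: "\<And>i. i < m \<Longrightarrow> u i \<in> carrier_vec m"
    and eig: "\<And>i A. i < m \<Longrightarrow> A \<in> F \<Longrightarrow> \<exists>\<mu>. A *\<^sub>v u i = \<mu> \<cdot>\<^sub>v u i"
    and orth: "\<And>i j. i < m \<Longrightarrow> j < m \<Longrightarrow> u i \<bullet>c u j = (if i = j then 1 else 0)"
    using commuting_hermitian_orthonormal_eigenvectors[OF F order_refl] by metis
  define U where "U = mat m m (\<lambda>(i, j). u j $ i)"
  have U: "U \<in> carrier_mat m m" by (simp add: U_def)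
  note U' = mat_adjoint_carrier[OF U]
  have "mat_adjoint U * U = 1\<^sub>m m"
  proof (rule eq_matI)
    fix k l assume kl: "k < dim_row (1\<^sub>m m :: complex mat)" "l < dim_col (1\<^sub>m m :: complex mat)"
    then have "(mat_adjoint U * U) $$ (k, l) = (\<Sum>i<m. cnj (U $$ (i, k)) * U $$ (i, l))"
      using U U' by (simp add: scalar_prod_def mat_adjoint_index[OF U] atLeast0LessThan)
    also have "\<dots> = u l \<bullet>c u k"
      using u kl by (simp add: cscalar_prod_sum[of _ m] U_def mult.commute)
    finally show "(mat_adjoint U * U) $$ (k, l) = 1\<^sub>m m $$ (k, l)"
      using orth kl by simp
  qed (use U U' in auto)
  then have unit: "unitary U" using U by (auto simp: unitary_def)
  have UU: "U * mat_adjoint U = 1\<^sub>m m"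
    using mat_mult_left_right_inverse[OF U' U] \<open>mat_adjoint U * U = 1\<^sub>m m\<close> by blast
  have "\<exists>d. A = spectral_form m U d" if A: "A \<in> F" for A
  proof -
    have Ac: "A \<in> carrier_mat m m" using A F by blast
    have "\<exists>d. A *\<^sub>v u i = complex_of_real d \<cdot>\<^sub>v u i" if i: "i < m" for i
    proof -
      obtain \<mu> where \<mu>: "A *\<^sub>v u i = \<mu> \<cdot>\<^sub>v u i" using eig[OF i A] by blast
      have "(A *\<^sub>v u i) \<bullet>c u i = u i \<bullet>c (A *\<^sub>v u i)"
        by (rule hermitian_self_adjoint[OF Ac F(3)[OF A] u[OF i] u[OF i]])
      then have "\<mu> = cnj \<mu>"
        unfolding \<mu> using u[OF i] orth[OF i i] by (simp add: conjugate_smult_vec)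
      then have "\<mu> = complex_of_real (Re \<mu>)" by (simp add: complex_eq_iff)
      then show ?thesis using \<mu> by metis
    qed
    then obtain d where d: "\<And>i. i < m \<Longrightarrow> A *\<^sub>v u i = complex_of_real (d i) \<cdot>\<^sub>v u i"
      by metis
    have "A * U = U * mat_diag m (\<lambda>i. complex_of_real (d i))"
    proof (rule eq_matI)
      fix i j assume "i < dim_row (U * mat_diag m (\<lambda>i. complex_of_real (d i)))"
        "j < dim_col (U * mat_diag m (\<lambda>i. complex_of_real (d i)))"
      then have ij: "i < m" "j < m" using U by (auto simp: mat_diag_def)
      have "col U j = u j" using ij u[OF ij(2)] by (intro eq_vecI) (auto simp: U_def)
      then have "(A * U) $$ (i, j) = (A *\<^sub>v u j) $ i" using ij Ac U by simp
      also have "\<dots> = complex_of_real (d j) * u j $ i" using d[OF ij(2)] u[OF ij(2)] ij by simp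
      finally show "(A * U) $$ (i, j) = (U * mat_diag m (\<lambda>i. complex_of_real (d i))) $$ (i, j)"
        using ij by (simp add: mat_diag_mult_right[OF U]) (simp add: U_def)
    qed (use Ac U in \<open>auto simp: mat_diag_def\<close>)
    then have "A * U * mat_adjoint U = spectral_form m U d"
      by (simp add: spectral_form_def)
    moreover have "A * U * mat_adjoint U = A"
      using Ac U U' UU by (simp add: assoc_mult_mat[of _ m m _ m _ m])
    ultimately show ?thesis by metis
  qed
  then show ?thesis using U unit by blast
qed

section \<open>Block matrices with simultaneously diagonal blocks\<close>

lemma sum_blocks:
  fixes f :: "nat \<Rightarrow> 'a::comm_monoid_add"
  shows "(\<Sum>p<m * n. f p) = (\<Sum>s<n. \<Sum>i<m. f (s * m + i))"
proof -
  have "(\<Sum>p<m * n. f p) = (\<Sum>s<n. sum f {s * m..<s * m + m})"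
    by (simp add: sum.nat_group mult.commute)
  also have "\<dots> = (\<Sum>s<n. \<Sum>i<m. f (s * m + i))"
    by (rule sum.cong[OF refl]) (simp add: sum.atLeastLessThan_shift_0 atLeast0LessThan)
  finally show ?thesis .
qed

lemma block_index_less:
  fixes s i m n :: nat
  assumes "s < n" "i < m" shows "s * m + i < m * n"
proof -
  have "s * m + i < Suc s * m" using assms by simp
  also have "\<dots> \<le> n * m" using assms by (intro mult_le_mono1) simp
  finally show ?thesis by (simp add: mult.commute)
qed

lemma block_mat_index:
  assumes "s < n" "i < m" "t < n" "j < m"
  shows "block_mat m n H $$ (s * m + i, t * m + j) = H s t $$ (i, j)"
  using assms block_index_less[of s n i m] block_index_less[of t n j m] by (simp add: block_mat_def)

lemma block_mat_carrier: "block_mat m n H \<in> carrier_mat (m * n) (m * n)"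
  by (simp add: block_mat_def)

lemma block_mat_cong:
  assumes "\<And>s t. s < n \<Longrightarrow> t < n \<Longrightarrow> H s t = K s t"
  shows "block_mat m n H = block_mat m n K"
  unfolding block_mat_def
  by (rule cong_mat) (use assms in \<open>auto simp: less_mult_imp_div_less mult.commute\<close>)

text \<open>Here \<open>y s k\<close> is the coordinate of the \<open>s\<close>-th block of \<open>x\<close> along the \<open>k\<close>-th column of \<open>U\<close>.  In these
  coordinates the form decouples into one form of size \<open>n\<close> for each common eigenvector.\<close>

lemma block_mat_quad_form:
  fixes U d x
  assumes U: "U \<in> carrier_mat m m" and x: "x \<in> carrier_vec (m * n)"
  defines "y \<equiv> \<lambda>s k. \<Sum>i<m. cnj (U $$ (i, k)) * x $ (s * m + i)"
  shows "(block_mat m n (\<lambda>s t. spectral_form m U (d s t)) *\<^sub>v x) \<bullet>c x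
    = (\<Sum>k<m. \<Sum>s<n. \<Sum>t<n. complex_of_real (d s t k) * (cnj (y s k) * y t k))"
proof -
  let ?B = "block_mat m n (\<lambda>s t. spectral_form m U (d s t))"
  let ?T = "\<lambda>s t i j k. complex_of_real (d s t k) *
      ((U $$ (i, k) * cnj (x $ (s * m + i))) * (cnj (U $$ (j, k)) * x $ (t * m + j)))"
  have Bx: "?B *\<^sub>v x \<in> carrier_vec (m * n)"
    by (rule mult_mat_vec_carrier[OF block_mat_carrier x])
  have "(?B *\<^sub>v x) \<bullet>c x = (\<Sum>p<m * n. (\<Sum>q<m * n. ?B $$ (p, q) * x $ q) * cnj (x $ p))"
    unfolding cscalar_prod_sum[OF Bx x]
    by (rule sum.cong[OF refl])
      (simp add: mult_mat_vec_index[OF block_mat_carrier x] del: index_mult_mat_vec)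
  also have "\<dots> = (\<Sum>s<n. \<Sum>i<m.
      (\<Sum>t<n. \<Sum>j<m. ?B $$ (s * m + i, t * m + j) * x $ (t * m + j)) * cnj (x $ (s * m + i)))"
    unfolding sum_blocks ..
  also have "\<dots> = (\<Sum>s<n. \<Sum>i<m. \<Sum>t<n. \<Sum>j<m. \<Sum>k<m. ?T s t i j k)"
  proof (rule sum.cong[OF refl], rule sum.cong[OF refl])
    fix s i assume si: "s \<in> {..<n}" "i \<in> {..<m}"
    have "?B $$ (s * m + i, t * m + j) * x $ (t * m + j) * cnj (x $ (s * m + i)) = (\<Sum>k<m. ?T s t i j k)"
      if "t < n" "j < m" for t j
    proof -
      have "?B $$ (s * m + i, t * m + j) = (\<Sum>k<m. U $$ (i, k) * complex_of_real (d s t k) * cnj (U $$ (j, k)))"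
        using si that by (simp add: block_mat_index spectral_form_index[OF U])
      then show ?thesis
        unfolding sum_distrib_right
          by (simp only: sum_distrib_right) (rule sum.cong[OF refl], simp only: mult_ac)
    qed
    then show "(\<Sum>t<n. \<Sum>j<m. ?B $$ (s * m + i, t * m + j) * x $ (t * m + j)) * cnj (x $ (s * m + i))
        = (\<Sum>t<n. \<Sum>j<m. \<Sum>k<m. ?T s t i j k)"
      unfolding sum_distrib_right by simp
  qed
  also have "\<dots> = (\<Sum>s<n. \<Sum>t<n. \<Sum>i<m. \<Sum>j<m. \<Sum>k<m. ?T s t i j k)"
    by (rule sum.cong[OF refl sum.swap])
  also have "\<dots> = (\<Sum>s<n. \<Sum>t<n. \<Sum>k<m. \<Sum>i<m. \<Sum>j<m. ?T s t i j k)"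
  proof (rule sum.cong[OF refl], rule sum.cong[OF refl])
    fix s t
    have "(\<Sum>i<m. \<Sum>j<m. \<Sum>k<m. ?T s t i j k) = (\<Sum>i<m. \<Sum>k<m. \<Sum>j<m. ?T s t i j k)"
      by (rule sum.cong[OF refl sum.swap])
    also have "\<dots> = (\<Sum>k<m. \<Sum>i<m. \<Sum>j<m. ?T s t i j k)" by (rule sum.swap)
    finally show "(\<Sum>i<m. \<Sum>j<m. \<Sum>k<m. ?T s t i j k) = (\<Sum>k<m. \<Sum>i<m. \<Sum>j<m. ?T s t i j k)" .
  qed
  also have "\<dots> = (\<Sum>s<n. \<Sum>t<n. \<Sum>k<m. complex_of_real (d s t k) * (cnj (y s k) * y t k))"
    unfolding y_def cnj_sum sum_product by (simp add: sum_distrib_left)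
  also have "\<dots> = (\<Sum>s<n. \<Sum>k<m. \<Sum>t<n. complex_of_real (d s t k) * (cnj (y s k) * y t k))"
    by (rule sum.cong[OF refl sum.swap])
  also have "\<dots> = (\<Sum>k<m. \<Sum>s<n. \<Sum>t<n. complex_of_real (d s t k) * (cnj (y s k) * y t k))"
    by (rule sum.swap)
  finally show ?thesis .
qed

text \<open>The mixed terms of real and imaginary parts cancel by symmetry.\<close>

lemma complex_quad_form:
  assumes sym: "\<And>s t. s < n \<Longrightarrow> t < n \<Longrightarrow> A s t = A t s"
  shows "(\<Sum>s<n. \<Sum>t<n. complex_of_real (A s t) * (cnj (y s) * y t))
    = complex_of_real (quad_form n A (\<lambda>s. Re (y s)) + quad_form n A (\<lambda>s. Im (y s)))"
proof (rule complex_eqI)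
  show "Re (\<Sum>s<n. \<Sum>t<n. complex_of_real (A s t) * (cnj (y s) * y t)) =
    Re (complex_of_real (quad_form n A (\<lambda>s. Re (y s)) + quad_form n A (\<lambda>s. Im (y s))))"
    by (simp add: quad_form_def sum.distrib ring_distribs mult_ac)
  have "(\<Sum>s<n. \<Sum>t<n. A s t * (Im (y s) * Re (y t))) = (\<Sum>t<n. \<Sum>s<n. A s t * (Im (y s) * Re (y t)))"
    by (rule sum.swap)
  also have "\<dots> = (\<Sum>s<n. \<Sum>t<n. A s t * (Re (y s) * Im (y t)))"
    by (intro sum.cong refl) (simp add: sym mult_ac)
  finally show "Im (\<Sum>s<n. \<Sum>t<n. complex_of_real (A s t) * (cnj (y s) * y t)) =
    Im (complex_of_real (quad_form n A (\<lambda>s. Re (y s)) + quad_form n A (\<lambda>s. Im (y s))))"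
    by (simp add: right_diff_distrib sum_subtractf)
qed

text \<open>The reduction from block matrices to entrywise questions: up to a unitary change of basis and a
  permutation, the block matrix is the direct sum of the \<open>m\<close> matrices of joint eigenvalues.\<close>

lemma psd_block_spectral_iff:
  assumes U: "U \<in> carrier_mat m m" "unitary U"
    and sym: "\<And>s t k. s < n \<Longrightarrow> t < n \<Longrightarrow> k < m \<Longrightarrow> d s t k = d t s k"
  shows "psd (block_mat m n (\<lambda>s t. spectral_form m U (d s t)))
    \<longleftrightarrow> (\<forall>k<m. real_psd n (\<lambda>s t. d s t k))" (is "psd ?B \<longleftrightarrow> _")
proof
  assume psd: "psd ?B"
  show "\<forall>k<m. real_psd n (\<lambda>s t. d s t k)"
  proof (intro allI impI real_psdI)
    fix k v assume k: "k < m"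
    (* test vector supported on the k-th common eigenvector, which isolates the k-th summand *)
    define x where "x = vec (m * n) (\<lambda>p. complex_of_real (v (p div m)) * U $$ (p mod m, k))"
    have x: "x \<in> carrier_vec (m * n)" by (simp add: x_def)
    have xi: "x $ (s * m + i) = complex_of_real (v s) * U $$ (i, k)" if "s < n" "i < m" for s i
      using block_index_less[OF that] that by (simp add: x_def)
    have y: "(\<Sum>i<m. cnj (U $$ (i, l)) * x $ (s * m + i)) = (if l = k then complex_of_real (v s) else 0)"
      if "s < n" "l < m" for s l
    proof -
      have "(\<Sum>i<m. cnj (U $$ (i, l)) * x $ (s * m + i))
          = complex_of_real (v s) * (\<Sum>i<m. cnj (U $$ (i, l)) * U $$ (i, k))"
        unfolding sum_distrib_left by (intro sum.cong refl) (simp add: xi that)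
      then show ?thesis using unitary_columns[OF U that(2) k] by simp
    qed
    have "(?B *\<^sub>v x) \<bullet>c x = (\<Sum>l<m. if l = k then complex_of_real (quad_form n (\<lambda>s t. d s t k) v) else 0)"
      unfolding block_mat_quad_form[OF U(1) x]
      by (intro sum.cong refl) (auto simp: y quad_form_def mult_ac intro!: sum.cong sum.neutral)
    also have "\<dots> = complex_of_real (quad_form n (\<lambda>s t. d s t k) v)" using k by simp
    finally have "(?B *\<^sub>v x) \<bullet>c x = complex_of_real (quad_form n (\<lambda>s t. d s t k) v)" .
    moreover have "0 \<le> (?B *\<^sub>v x) \<bullet>c x"
      using psd x block_mat_carrier[of m n] unfolding psd_def by (metis carrier_matD(1))
    ultimately show "0 \<le> quad_form n (\<lambda>s t. d s t k) v" by (simp add: less_eq_complex_def)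
  qed (rule sym)
next
  assume real: "\<forall>k<m. real_psd n (\<lambda>s t. d s t k)"
  have "hermitian ?B"
  proof (rule hermitianI[OF block_mat_carrier])
    fix p q assume pq: "p < m * n" "q < m * n"
    then have "m > 0" by (cases m) auto
    have lt: "p div m < n" "q div m < n" using pq by (auto simp: less_mult_imp_div_less mult.commute)
    show "?B $$ (p, q) = cnj (?B $$ (q, p))"
      using pq \<open>m > 0\<close> unfolding block_mat_def
      by (simp add: spectral_form_index[OF U(1)] cnj_sum sym[OF lt] mult_ac)
  qed
  moreover have "0 \<le> (?B *\<^sub>v x) \<bullet>c x" if x: "x \<in> carrier_vec (m * n)" for x
    unfolding block_mat_quad_form[OF U(1) x]
  proof (rule sum_nonneg)
    fix k assume k: "k \<in> {..<m}"
    have "(\<Sum>s<n. \<Sum>t<n. complex_of_real (d s t k) * (cnj (y s) * y t)) \<ge> 0" for y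
      by (subst complex_quad_form)
        (use k real sym in \<open>auto simp: less_eq_complex_def intro!: add_nonneg_nonneg real_psd_nonneg\<close>)
    then show "0 \<le> (\<Sum>s<n. \<Sum>t<n. complex_of_real (d s t k) *
        (cnj (\<Sum>i<m. cnj (U $$ (i, k)) * x $ (s * m + i)) * (\<Sum>i<m. cnj (U $$ (i, k)) * x $ (t * m + i))))" .
  qed
  ultimately show "psd ?B" by (simp add: psd_def carrier_matD[OF block_mat_carrier])
qed

text \<open>A single matrix is a block matrix with one block.\<close>

lemma psd_spectral_form_iff:
  assumes U: "U \<in> carrier_mat m m" "unitary U"
  shows "psd (spectral_form m U d) \<longleftrightarrow> (\<forall>k<m. 0 \<le> d k)"
proof -
  have "block_mat m 1 (\<lambda>s t. spectral_form m U d) = spectral_form m U d"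
    using spectral_form_carrier[OF U(1), of d] by (intro eq_matI) (auto simp: block_mat_def)
  moreover have "real_psd 1 (\<lambda>s t. c) \<longleftrightarrow> 0 \<le> c" for c
  proof -
    have "quad_form 1 (\<lambda>s t. c) v = c * (v 0)\<^sup>2" for v
      by (simp add: quad_form_def power2_eq_square mult_ac)
    then show ?thesis
      unfolding real_psd_def by (auto dest: spec[of _ "\<lambda>_. 1"])
  qed
  ultimately show ?thesis
    using psd_block_spectral_iff[OF U, of 1 "\<lambda>s t. d"] by simp
qed

lemma mem_psd_mats_UNIV: "A \<in> psd_mats N UNIV \<longleftrightarrow> A \<in> carrier_mat N N \<and> psd A"
  by (simp add: psd_mats_def)

text \<open>Diagonalizing all blocks at once turns the power of the blocks into the entrywise power of the
  matrices of joint eigenvalues, to which the entrywise results apply.\<close>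

lemma block_power_psd:
  assumes "n \<ge> 2" "\<alpha> > 0" and \<alpha>: "\<alpha> \<in> real ` {1..} \<union> {real n - 2..}"
    and psd: "psd (block_mat m n H)"
    and blocks: "\<And>s t. s < n \<Longrightarrow> t < n \<Longrightarrow> H s t \<in> carrier_mat m m"
      "\<And>s t. s < n \<Longrightarrow> t < n \<Longrightarrow> psd (H s t)"
    and comm: "blocks_commute n H"
  shows "psd (block_mat m n (\<lambda>s t. mat_power (H s t) \<alpha>))"
proof -
  define F where "F = (\<lambda>(s, t). H s t) ` ({..<n} \<times> {..<n})"
  have "\<exists>U\<in>carrier_mat m m. unitary U \<and> (\<forall>A\<in>F. \<exists>d. A = spectral_form m U d)"
  proof (rule commuting_hermitian_simultaneous_diagonalization)
    show "F \<subseteq> carrier_mat m m" using blocks(1) by (auto simp: F_def)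
    show "hermitian A" if "A \<in> F" for A using blocks(2) that by (auto simp: F_def psd_def)
    show "A * B = B * A" if "A \<in> F" "B \<in> F" for A B
      using comm that by (auto simp: F_def blocks_commute_def)
  qed (simp add: F_def)
  then obtain U where U: "U \<in> carrier_mat m m" "unitary U"
    and "\<And>A. A \<in> F \<Longrightarrow> \<exists>d. A = spectral_form m U d" by blast
  then obtain D where D: "\<And>A. A \<in> F \<Longrightarrow> A = spectral_form m U (D A)" by metis
  define d where "d s t = D (H s t)" for s t
  have H: "H s t = spectral_form m U (d s t)" if "s < n" "t < n" for s t
    unfolding d_def using that by (intro D) (auto simp: F_def)
  (* the block matrix being hermitian makes H t s the adjoint of H s t, which is H s t itself *)
  have Hsym: "H s t = H t s" if st: "s < n" "t < n" for s t
  proof (rule eq_matI)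
    fix i j assume "i < dim_row (H t s)" "j < dim_col (H t s)"
    then have ij: "i < m" "j < m" using blocks(1)[OF st(2,1)] by auto
    have "H s t $$ (i, j) = cnj (H t s $$ (j, i))"
      using hermitian_index[OF block_mat_carrier[of m n H], of "s * m + i" "t * m + j"] psd
        block_index_less[OF st(1) ij(1)] block_index_less[OF st(2) ij(2)]
      by (simp add: block_mat_index st ij psd_def)
    also have "\<dots> = H t s $$ (i, j)"
      using hermitian_index[OF blocks(1)[OF st(2,1)], of i j] blocks(2)[OF st(2,1)] ij
      by (simp add: psd_def)
    finally show "H s t $$ (i, j) = H t s $$ (i, j)" .
  qed (use blocks(1)[OF st] blocks(1)[OF st(2,1)] in auto)
  have dsym: "d s t = d t s" if "s < n" "t < n" for s t
    using Hsym[OF that] by (simp add: d_def)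
  have dnn: "0 \<le> d s t k" if "s < n" "t < n" "k < m" for s t k
    using blocks(2)[OF that(1,2)] psd_spectral_form_iff[OF U, of "d s t"] that H by simp
  have "psd (block_mat m n (\<lambda>s t. spectral_form m U (d s t)))"
    using psd block_mat_cong[of n H "\<lambda>s t. spectral_form m U (d s t)" m] H by simp
  then have rp: "real_psd n (\<lambda>s t. d s t k)" if "k < m" for k
    using psd_block_spectral_iff[OF U, of n d] dsym that by simp
  have "real_psd n (\<lambda>s t. d s t k powr \<alpha>)" if k: "k < m" for k
  proof (cases "\<alpha> \<ge> real n - 2")
    case True
    then show ?thesis using real_psd_powr[OF assms(1) rp[OF k] _ assms(2)] dnn k by blast
  next
    case False
    then obtain j where "\<alpha> = real j" "j \<ge> 1" using \<alpha> by auto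
    then show ?thesis using real_psd_powr_nat[OF rp[OF k], of j] dnn k by simp
  qed
  then have "psd (block_mat m n (\<lambda>s t. spectral_form m U (\<lambda>k. d s t k powr \<alpha>)))"
    using psd_block_spectral_iff[OF U, of n "\<lambda>s t k. d s t k powr \<alpha>"] dsym by simp
  moreover have "block_mat m n (\<lambda>s t. mat_power (H s t) \<alpha>)
      = block_mat m n (\<lambda>s t. spectral_form m U (\<lambda>k. d s t k powr \<alpha>))"
    by (rule block_mat_cong) (simp add: H mat_power_spectral_form[OF U])
  ultimately show ?thesis by simp
qed

section \<open>Scalar blocks\<close>

text \<open>Blocks that are real multiples of the identity carry the entrywise counterexamples over to block
  matrices of any block size.\<close>

definition scalar_mat :: "nat \<Rightarrow> real \<Rightarrow> complex mat" where
  "scalar_mat m a = complex_of_real a \<cdot>\<^sub>m 1\<^sub>m m"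

lemma adjoint_one: "mat_adjoint (1\<^sub>m m) = (1\<^sub>m m :: complex mat)"
  using mat_adjoint_carrier[of "1\<^sub>m m" m]
  by (intro eq_matI) (auto simp: mat_adjoint_index[of _ m m])

lemma unitary_one: "unitary (1\<^sub>m m)"
  by (simp add: unitary_def adjoint_one)

lemma scalar_mat_spectral_form: "scalar_mat m a = spectral_form m (1\<^sub>m m) (\<lambda>_. a)"
  using mat_diag_dim[of m "\<lambda>_. complex_of_real a"]
  unfolding spectral_form_def adjoint_one
  by (intro eq_matI) (auto simp: scalar_mat_def mat_diag_def)

lemma mat_power_scalar_mat: "mat_power (scalar_mat m a) \<alpha> = scalar_mat m (a powr \<alpha>)"
  unfolding scalar_mat_spectral_form by (rule mat_power_spectral_form[OF one_carrier_mat unitary_one])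

lemma psd_block_scalar_iff:
  assumes "m > 0" "\<And>s t. s < n \<Longrightarrow> t < n \<Longrightarrow> A s t = A t s"
  shows "psd (block_mat m n (\<lambda>s t. scalar_mat m (A s t))) \<longleftrightarrow> real_psd n A"
  unfolding scalar_mat_spectral_form
  using psd_block_spectral_iff[OF one_carrier_mat unitary_one, of n m "\<lambda>s t k. A s t"] assms by auto

lemma scalar_mat_carrier: "scalar_mat m a \<in> carrier_mat m m"
  by (simp add: scalar_mat_def)

lemma psd_scalar_mat: "0 \<le> a \<Longrightarrow> psd (scalar_mat m a)"
  unfolding scalar_mat_spectral_form using psd_spectral_form_iff[OF one_carrier_mat unitary_one] by simp

lemma scalar_mat_commute: "scalar_mat m a * scalar_mat m b = scalar_mat m b * scalar_mat m a"
  by (intro eq_matI) (auto simp: scalar_mat_def)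

lemma elements_scalar_mat: "elements_mat (scalar_mat m a) \<subseteq> \<real>"
  by (auto dest!: elements_matD simp: scalar_mat_def)

lemma real_sym_pos_def_scalar_mat:
  assumes "0 < a" shows "real_sym_pos_def m (scalar_mat m a)"
proof -
  have "(scalar_mat m a *\<^sub>v x) \<bullet>c x = complex_of_real a * (x \<bullet>c x)" if x: "x \<in> carrier_vec m" for x
  proof -
    have "scalar_mat m a *\<^sub>v x = complex_of_real a \<cdot>\<^sub>v x"
      using x by (intro eq_vecI) (auto simp: scalar_mat_def)
    then show ?thesis using x by simp
  qed
  moreover have "0 < complex_of_real a * c" if "0 < c" for c
    using that assms by (simp add: less_complex_def)
  ultimately have "pos_def (scalar_mat m a)"
    using psd_scalar_mat[of a m] assms scalar_mat_carrier[of m a]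
    by (auto simp: pos_def_def psd_def)
  moreover have "(scalar_mat m a)\<^sup>T = scalar_mat m a"
    by (intro eq_matI) (auto simp: scalar_mat_def)
  ultimately show ?thesis
    using scalar_mat_carrier elements_scalar_mat by (simp add: real_sym_pos_def_def)
qed

lemma elements_block_scalar_mat: "elements_mat (block_mat m n (\<lambda>s t. scalar_mat m (A s t))) \<subseteq> \<real>"
proof
  fix z assume "z \<in> elements_mat (block_mat m n (\<lambda>s t. scalar_mat m (A s t)))"
  then obtain p q where pq: "p < m * n" "q < m * n"
    and z: "z = block_mat m n (\<lambda>s t. scalar_mat m (A s t)) $$ (p, q)"
    by (auto simp: block_mat_def dest!: elements_matD)
  then have "m > 0" by (cases m) auto
  then show "z \<in> \<real>" using pq unfolding z by (simp add: block_mat_def scalar_mat_def)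
qed

section \<open>Powers of commuting blocks\<close>

theorem theorem2:
  fixes m n :: nat and \<alpha> :: real
  assumes "m \<ge> 2" and "n \<ge> 2" and "\<alpha> \<noteq> 0"
  shows
    "(\<alpha> > 0 \<longrightarrow> \<alpha> \<in> real ` {1..} \<union> {real n - 2..} \<longrightarrow>
        (\<forall>H. block_mat m n H \<in> psd_mats (m * n) UNIV \<longrightarrow>
             (\<forall>s<n. \<forall>t<n. H s t \<in> psd_mats m UNIV) \<longrightarrow>
             blocks_commute n H \<longrightarrow>
             block_mat m n (\<lambda>s t. mat_power (H s t) \<alpha>) \<in> psd_mats (m * n) UNIV))
   \<and> (\<alpha> > 0 \<longrightarrow> \<alpha> \<notin> real ` {1..} \<union> {real n - 2..} \<longrightarrow>
        (\<exists>H. (\<forall>s<n. \<forall>t<n. H s t \<in> psd_mats m UNIV) \<and>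
             block_mat m n H \<in> psd_mats (m * n) UNIV \<and>
             blocks_commute n H \<and>
             \<not> psd (block_mat m n (\<lambda>s t. mat_power (H s t) \<alpha>))))
   \<and> (\<alpha> < 0 \<longrightarrow>
        (\<exists>H. (\<forall>s<n. \<forall>t<n. real_sym_pos_def m (H s t)) \<and>
             block_mat m n H \<in> psd_mats (m * n) \<real> \<and>
             \<not> psd (block_mat m n (\<lambda>s t. mat_power (H s t) \<alpha>))))"
proof (intro conjI impI allI)
  fix H
  assume "\<alpha> > 0" "\<alpha> \<in> real ` {1..} \<union> {real n - 2..}"
    "block_mat m n H \<in> psd_mats (m * n) UNIV" "\<forall>s<n. \<forall>t<n. H s t \<in> psd_mats m UNIV"
    "blocks_commute n H"
  then show "block_mat m n (\<lambda>s t. mat_power (H s t) \<alpha>) \<in> psd_mats (m * n) UNIV"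
    using block_power_psd[OF assms(2), of \<alpha> m H] by (simp add: mem_psd_mats_UNIV block_mat_carrier)
next
  assume "\<alpha> > 0" "\<alpha> \<notin> real ` {1..} \<union> {real n - 2..}"
  then obtain A where A: "real_psd n A" "\<And>s t. A s t > 0" "\<not> real_psd n (\<lambda>s t. A s t powr \<alpha>)"
    using ex_real_psd_not_powr by blast
  have m: "m > 0" using assms(1) by simp
  show "\<exists>H. (\<forall>s<n. \<forall>t<n. H s t \<in> psd_mats m UNIV) \<and>
             block_mat m n H \<in> psd_mats (m * n) UNIV \<and> blocks_commute n H \<and>
             \<not> psd (block_mat m n (\<lambda>s t. mat_power (H s t) \<alpha>))"
    by (rule exI[of _ "\<lambda>s t. scalar_mat m (A s t)"])
      (use A m real_psd_sym[OF A(1)] in \<open>simp add: mem_psd_mats_UNIV block_mat_carrier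
        scalar_mat_carrier psd_scalar_mat less_imp_le psd_block_scalar_iff mat_power_scalar_mat
        blocks_commute_def scalar_mat_commute\<close>)
next
  assume "\<alpha> < 0"
  then obtain A where A: "real_psd n A" "\<And>s t. A s t > 0" "\<not> real_psd n (\<lambda>s t. A s t powr \<alpha>)"
    using ex_real_psd_not_powr_neg assms(2) by blast
  have m: "m > 0" using assms(1) by simp
  show "\<exists>H. (\<forall>s<n. \<forall>t<n. real_sym_pos_def m (H s t)) \<and>
             block_mat m n H \<in> psd_mats (m * n) \<real> \<and>
             \<not> psd (block_mat m n (\<lambda>s t. mat_power (H s t) \<alpha>))"
    by (rule exI[of _ "\<lambda>s t. scalar_mat m (A s t)"])
      (use A m real_psd_sym[OF A(1)] in \<open>simp add: psd_mats_def block_mat_carrier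
        real_sym_pos_def_scalar_mat psd_block_scalar_iff mat_power_scalar_mat
        elements_block_scalar_mat\<close>)
qed

end
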